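(* Let $y(x)$ be the formal power series with zero constant term satisfying $x=y\prod_{m\ge1}(1-y^m)$. Then $$y(x)=\sum_{n\ge1}\frac{x^n}{n}\sum_{\lambda\vdash n-1}\prod_{v\in\lambda}\Bigl(1+\frac{n-1}{h_v^2}\Bigr).$$
   Context: $\lambda\vdash n-1$ means $\lambda$ is a partition of $n-1$ (the empty partition for $n=1$). The boxes of $\lambda$ are the pairs $(i,j)$ with $1\le j\le \lambda_i$; the hook length of $v=(i,j)$ is $h_v=\lambda_i-j+\lambda'_j-i+1$ with $\lambda'_j=\#\{k:\lambda_k\ge j\}$. An empty product equals $1$. *)

theory Defs
  imports "HOL-Analysis.Analysis" "HOL-Computational_Algebra.Formal_Power_Series"
begin

text \<open>A partition is the weakly decreasing list of its positive parts.\<close>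

definition partitions :: "nat \<Rightarrow> nat list set" where
  "partitions n = {\<mu>. sorted_wrt (\<ge>) \<mu> \<and> 0 \<notin> set \<mu> \<and> sum_list \<mu> = n}"

text \<open>Rows and columns are counted from 1, while list positions are counted from 0.\<close>

definition part :: "nat list \<Rightarrow> nat \<Rightarrow> nat" where
  "part \<mu> i = (if 1 \<le> i \<and> i \<le> length \<mu> then \<mu> ! (i - 1) else 0)"

definition conj_part :: "nat list \<Rightarrow> nat \<Rightarrow> nat" where
  "conj_part \<mu> j = card {k. 1 \<le> k \<and> k \<le> length \<mu> \<and> part \<mu> k \<ge> j}"

definition boxes :: "nat list \<Rightarrow> (nat \<times> nat) set" where
  "boxes \<mu> = {(i, j). 1 \<le> i \<and> i \<le> length \<mu> \<and> 1 \<le> j \<and> j \<le> part \<mu> i}"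

text \<open>Integer-valued, so that none of the subtractions is truncated.\<close>

definition hook_length :: "nat list \<Rightarrow> nat \<times> nat \<Rightarrow> int" where
  "hook_length \<mu> v = (case v of (i, j) \<Rightarrow>
     int (part \<mu> i) - int j + int (conj_part \<mu> j) - int i + 1)"

end

theory Submission
  imports Defs "Jordan_Normal_Form.Char_Poly"
begin

text \<open>By Lagrange inversion the coefficient of \<open>x^n\<close> in \<open>y\<close> is \<open>1/n\<close> times the coefficient of
  \<open>q^(n - 1)\<close> in \<open>E^(-n)\<close>, where \<open>E\<close> is the product of all \<open>1 - q^m\<close>. So the theorem is the
  Nekrasov--Okounkov identity, which says that the sum over all partitions of
  \<open>q^|\<lambda>|\<close> times the product of \<open>1 - z/h^2\<close> over the hook lengths is \<open>E^(z - 1)\<close>, at \<open>z = 1 - n\<close>.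

  Coefficients are polynomials in \<open>z\<close>, so it suffices to take \<open>z = t^2\<close> with \<open>t\<close> a positive integer.
  A partition with at most \<open>N\<close> parts is the set of its \<open>N\<close> first-column hook lengths, that is, a basis
  vector of an \<open>N\<close>-th exterior power. The diagonal entry at such a vector of the exterior power of
  \<open>(1 - S)^(-t) (1 - S*)^t\<close>, with \<open>S\<close> the shift, is a Cauchy determinant equal to the hook product.
  The graded trace of this operator follows from the commutation rule
  \<open>(1 - S*)^t (1 - xS)^(-t) = (1 - x)^(t^2) (1 - xS)^(-t) (1 - S*)^t\<close>, valid on the exterior power
  in low degree: moving the raising factor around the trace replaces \<open>x\<close> by \<open>qx\<close>, so the trace is
  \<open>E^(t^2)\<close> times the generating function of partitions. For \<open>t = 1\<close> every nonempty partition
  has a hook of length 1, so this trace is 1 and the generating function is \<open>1/E\<close>.\<close>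

section \<open>Minors and the Cauchy--Binet formula\<close>

text \<open>Strictly increasing lists index the standard basis of the \<open>n\<close>-th exterior
  power.\<close>

definition incr_lists :: "nat \<Rightarrow> nat set \<Rightarrow> nat list set" where
  "incr_lists n J = {xs. length xs = n \<and> sorted_wrt (<) xs \<and> set xs \<subseteq> J}"

text \<open>The entry at \<open>(xs, ys)\<close> of the exterior power of an infinite matrix. The
  size is read off from \<open>xs\<close>; \<open>ys\<close> is meant to have the same
  length.\<close>

definition minor :: "(nat \<Rightarrow> nat \<Rightarrow> 'a::comm_ring_1) \<Rightarrow> nat list \<Rightarrow> nat list \<Rightarrow> 'a" where
  "minor X xs ys = det (mat (length xs) (length xs) (\<lambda>(i, j). X (xs ! i) (ys ! j)))"

lemma finite_incr_lists: "finite J \<Longrightarrow> finite (incr_lists n J)"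
  by (rule finite_subset[OF _ finite_lists_length_eq[of J n]]) (auto simp: incr_lists_def)

lemma minor_leibniz:
  "minor X xs ys = (\<Sum>p | p permutes {0..<length xs}.
     signof p * (\<Prod>i = 0..<length xs. X (xs ! i) (ys ! p i)))"
  unfolding minor_def
  by (subst det_def'[where n = "length xs"])
     (auto intro!: sum.cong prod.cong arg_cong2[where f = "(*)"] dest: permutes_in_image)

lemma minor_permute_rows:
  assumes "\<sigma> permutes {0..<length bs}"
  shows "minor Y (map (\<lambda>i. bs ! \<sigma> i) [0..<length bs]) cs = signof \<sigma> * minor Y bs cs"
proof -
  let ?n = "length bs"
  let ?A = "mat ?n ?n (\<lambda>(i, j). Y (bs ! i) (cs ! j))"
  have "minor Y (map (\<lambda>i. bs ! \<sigma> i) [0..<?n]) cs = det (mat ?n ?n (\<lambda>(i, j). ?A $$ (\<sigma> i, j)))"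
    unfolding minor_def using assms
    by (intro arg_cong[where f = det] eq_matI) (auto dest: permutes_in_image)
  also have "\<dots> = signof \<sigma> * det ?A"
    by (rule det_permute_rows) (use assms in auto)
  finally show ?thesis by (simp add: minor_def)
qed

lemma minor_repeated_row:
  assumes "\<not> inj_on b {0..<n}"
  shows "minor Y (map b [0..<n]) cs = 0"
proof -
  obtain i j where ij: "i < n" "j < n" "i \<noteq> j" "b i = b j"
    using assms by (auto simp: inj_on_def)
  show ?thesis
    unfolding minor_def using ij
    by (intro det_identical_rows[of _ n i j]) (auto intro!: eq_vecI)
qed

text \<open>An injective tuple amounts to its sorted image together with the permutation that puts
  the entries back in place.\<close>

lemma sum_injective_tuples:
  fixes n :: nat and J :: "nat set" and g :: "(nat \<Rightarrow> nat) \<Rightarrow> 'a::comm_monoid_add"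
  assumes "finite J"
  shows "(\<Sum>b | b \<in> {0..<n} \<rightarrow>\<^sub>E J \<and> inj_on b {0..<n}. g b) =
    (\<Sum>bs\<in>incr_lists n J. \<Sum>\<sigma> | \<sigma> permutes {0..<n}. g (\<lambda>i\<in>{0..<n}. bs ! \<sigma> i))"
proof -
  let ?S = "incr_lists n J \<times> {\<sigma>. \<sigma> permutes {0..<n}}"
  let ?T = "{b. b \<in> {0..<n} \<rightarrow>\<^sub>E J \<and> inj_on b {0..<n}}"
  let ?\<phi> = "\<lambda>(bs :: nat list, \<sigma> :: nat \<Rightarrow> nat). (\<lambda>i\<in>{0..<n}. bs ! \<sigma> i)"
  have dist: "distinct bs" "length bs = n" "sorted bs" "set bs \<subseteq> J" if "bs \<in> incr_lists n J" for bs
    using that by (auto simp: incr_lists_def strict_sorted_iff)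
  have img: "?\<phi> (bs, \<sigma>) ` {0..<n} = set bs" if "bs \<in> incr_lists n J" "\<sigma> permutes {0..<n}" for bs \<sigma>
  proof -
    have "?\<phi> (bs, \<sigma>) ` {0..<n} = (!) bs ` (\<sigma> ` {0..<n})" by (auto simp: image_image)
    also have "\<dots> = set bs"
      using permutes_image[OF that(2)] dist[OF that(1)] by (metis list.set_map map_nth set_upt)
    finally show ?thesis .
  qed
  have "bij_betw ?\<phi> ?S ?T"
  proof (rule bij_betwI')
    fix u v assume u: "u \<in> ?S" and v: "v \<in> ?S"
    obtain bs \<sigma> where [simp]: "u = (bs, \<sigma>)" by (cases u)
    obtain cs \<tau> where [simp]: "v = (cs, \<tau>)" by (cases v)
    show "(?\<phi> u = ?\<phi> v) = (u = v)"
    proof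
      assume eq: "?\<phi> u = ?\<phi> v"
      have "set bs = ?\<phi> u ` {0..<n}" using img[of bs \<sigma>] u by simp
      also have "\<dots> = set cs" unfolding eq using img[of cs \<tau>] v by simp
      finally have "set bs = set cs" .
      hence bc: "bs = cs" using dist[of bs] dist[of cs] u v by (auto intro: sorted_distinct_set_unique)
      have "\<sigma> i = \<tau> i" for i
      proof (cases "i < n")
        case True
        hence "bs ! \<sigma> i = bs ! \<tau> i" using fun_cong[OF eq, of i] bc by simp
        moreover have "\<sigma> i < n" "\<tau> i < n"
          using True u v by (auto dest: permutes_in_image)
        ultimately show ?thesis using dist[of bs] u by (simp add: nth_eq_iff_index_eq)
      next
        case False
        thus ?thesis using u v by (auto simp: permutes_def)
      qed
      thus "u = v" using bc by auto
    qed auto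
  next
    fix u assume u: "u \<in> ?S"
    obtain bs \<sigma> where [simp]: "u = (bs, \<sigma>)" by (cases u)
    have s: "\<sigma> permutes {0..<n}" and d: "distinct bs" "length bs = n" "set bs \<subseteq> J"
      using u dist by auto
    have "?\<phi> u \<in> {0..<n} \<rightarrow>\<^sub>E J"
      using d(2,3) s by (fastforce dest: permutes_in_image nth_mem)
    moreover have "inj_on (?\<phi> u) {0..<n}"
    proof (rule inj_onI)
      fix i j assume ij: "i \<in> {0..<n}" "j \<in> {0..<n}" "?\<phi> u i = ?\<phi> u j"
      hence "bs ! \<sigma> i = bs ! \<sigma> j" by simp
      moreover have "\<sigma> i < n" "\<sigma> j < n" using ij(1,2) permutes_in_image[OF s] by auto
      ultimately have "\<sigma> i = \<sigma> j" using d by (simp add: nth_eq_iff_index_eq)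
      thus "i = j" using permutes_inj[OF s] by (auto dest: injD)
    qed
    ultimately show "?\<phi> u \<in> ?T" by simp
  next
    fix b assume b: "b \<in> ?T"
    define bs where "bs = sorted_list_of_set (b ` {0..<n})"
    have len: "length bs = n" using b by (simp add: bs_def card_image)
    have st: "set bs = b ` {0..<n}" by (simp add: bs_def)
    have bs: "bs \<in> incr_lists n J" using b st len by (auto simp: incr_lists_def bs_def)
    have bij1: "bij_betw ((!) bs) {0..<n} (b ` {0..<n})"
      using bij_betw_nth[of bs "{..<n}" "b ` {0..<n}"] len st dist[OF bs]
      by (simp add: atLeast0LessThan)
    have bij2: "bij_betw b {0..<n} (b ` {0..<n})" using b by (simp add: bij_betw_def)
    \<comment> \<open>\<open>\<sigma>\<close> looks up the position of \<open>b i\<close> in the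
      sorted image; being the identity elsewhere, it satisfies \<open>permutes\<close>.\<close>
    define \<sigma> where "\<sigma> = (\<lambda>i. if i \<in> {0..<n} then the_inv_into {0..<n} ((!) bs) (b i) else i)"
    have "bij_betw (the_inv_into {0..<n} ((!) bs) \<circ> b) {0..<n} {0..<n}"
      by (rule bij_betw_trans[OF bij2 bij_betw_the_inv_into[OF bij1]])
    hence "bij_betw \<sigma> {0..<n} {0..<n}"
      by (subst bij_betw_cong[of _ _ "the_inv_into {0..<n} ((!) bs) \<circ> b"]) (auto simp: \<sigma>_def)
    hence s: "\<sigma> permutes {0..<n}" by (rule bij_imp_permutes) (auto simp: \<sigma>_def)
    have "bs ! \<sigma> i = b i" if "i \<in> {0..<n}" for i
      using f_the_inv_into_f_bij_betw[OF bij1, of "b i"] that by (simp add: \<sigma>_def)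
    hence "b = ?\<phi> (bs, \<sigma>)" using b by (auto simp: fun_eq_iff PiE_def extensional_def)
    thus "\<exists>u\<in>?S. b = ?\<phi> u" using bs s by (intro bexI[of _ "(bs, \<sigma>)"]) auto
  qed
  from sum.reindex_bij_betw[OF this, of g] show ?thesis
    by (simp add: sum.cartesian_product split_def)
qed

text \<open>Multilinearity expands the minor over all tuples of indices in \<open>J\<close>. A tuple
  with a repetition gives a determinant with two equal rows, and the others are grouped by their
  sorted image. The factorization is assumed only at the entries of \<open>as\<close> and
  \<open>cs\<close>, so that infinite matrices can be cut down to a finite \<open>J\<close>.\<close>

lemma Cauchy_Binet:
  assumes J: "finite J" and len: "length as = n" "length cs = n"
    and Z: "\<And>a c. a \<in> set as \<Longrightarrow> c \<in> set cs \<Longrightarrow> Z a c = (\<Sum>b\<in>J. X a b * Y b c)"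
  shows "minor Z as cs = (\<Sum>bs\<in>incr_lists n J. minor X as bs * minor Y bs cs)"
proof -
  let ?P = "{p. p permutes {0..<n}}"
  define D where "D b = minor Y (map b [0..<n]) cs" for b
  have D: "D b = (\<Sum>p\<in>?P. signof p * (\<Prod>i = 0..<n. Y (b i) (cs ! p i)))" for b
    unfolding D_def minor_leibniz by simp
  have Dcong: "D b = D b'" if "\<And>i. i < n \<Longrightarrow> b i = b' i" for b b'
    unfolding D_def using that by (intro arg_cong2[where f = "minor Y"] map_cong) auto
  have "minor Z as cs = (\<Sum>p\<in>?P. signof p *
      (\<Prod>i = 0..<n. \<Sum>b\<in>J. X (as ! i) b * Y b (cs ! p i)))"
    unfolding minor_leibniz len using len
    by (intro sum.cong arg_cong2[where f = "(*)"] prod.cong refl Z)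
       (auto dest: permutes_in_image intro!: nth_mem)
  also have "\<dots> = (\<Sum>p\<in>?P. \<Sum>b\<in>{0..<n} \<rightarrow>\<^sub>E J.
      (\<Prod>i = 0..<n. X (as ! i) (b i)) * (signof p * (\<Prod>i = 0..<n. Y (b i) (cs ! p i))))"
    by (subst prod_sum_PiE) (auto simp: J sum_distrib_left prod.distrib mult_ac)
  also have "\<dots> = (\<Sum>b\<in>{0..<n} \<rightarrow>\<^sub>E J. (\<Prod>i = 0..<n. X (as ! i) (b i)) * D b)"
    unfolding D sum_distrib_left by (rule sum.swap)
  also have "\<dots> = (\<Sum>b | b \<in> {0..<n} \<rightarrow>\<^sub>E J \<and> inj_on b {0..<n}.
      (\<Prod>i = 0..<n. X (as ! i) (b i)) * D b)"
    using J by (intro sum.mono_neutral_right)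
      (auto simp: D_def minor_repeated_row intro!: finite_PiE)
  also have "\<dots> = (\<Sum>bs\<in>incr_lists n J. \<Sum>\<sigma>\<in>?P.
      (\<Prod>i = 0..<n. X (as ! i) (bs ! \<sigma> i)) * D (\<lambda>i. bs ! \<sigma> i))"
    unfolding sum_injective_tuples[OF J]
    by (intro sum.cong arg_cong2[where f = "(*)"] refl prod.cong Dcong) auto
  also have "\<dots> = (\<Sum>bs\<in>incr_lists n J. \<Sum>\<sigma>\<in>?P.
      (signof \<sigma> * (\<Prod>i = 0..<n. X (as ! i) (bs ! \<sigma> i))) * minor Y bs cs)"
  proof (intro sum.cong refl)
    fix bs \<sigma> assume "bs \<in> incr_lists n J" "\<sigma> \<in> ?P"
    hence "D (\<lambda>i. bs ! \<sigma> i) = signof \<sigma> * minor Y bs cs"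
      unfolding D_def using minor_permute_rows[of \<sigma> bs Y cs] by (auto simp: incr_lists_def)
    thus "(\<Prod>i = 0..<n. X (as ! i) (bs ! \<sigma> i)) * D (\<lambda>i. bs ! \<sigma> i) =
      (signof \<sigma> * (\<Prod>i = 0..<n. X (as ! i) (bs ! \<sigma> i))) * minor Y bs cs"
      by (simp add: mult_ac)
  qed
  also have "\<dots> = (\<Sum>bs\<in>incr_lists n J. minor X as bs * minor Y bs cs)"
    unfolding minor_leibniz[of X] len sum_distrib_right ..
  finally show ?thesis .
qed

section \<open>Commutation of raising and lowering operators\<close>

lemma incr_nth_ge:
  assumes "sorted_wrt (<) (xs :: nat list)" "i < length xs"
  shows "i \<le> xs ! i"
  using assms(2)
proof (induction i)
  case (Suc i)
  moreover have "xs ! i < xs ! Suc i" using assms(1) Suc.prems by (auto simp: sorted_wrt_iff_nth_less)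
  ultimately show ?case by simp
qed simp

text \<open>One entry above its index forces all later ones above theirs, which costs
  \<open>length xs - i > k\<close> in the sum. So a basis vector within \<open>k\<close> of the
  lowest degree contains the levels \<open>0, ..., t - 1\<close>.\<close>

lemma incr_nth_eq:
  assumes incr: "sorted_wrt (<) (xs :: nat list)"
    and sum: "sum_list xs \<le> (\<Sum>i<length xs. i) + k" and len: "k + t \<le> length xs" and i: "i < t"
  shows "xs ! i = i"
proof (rule ccontr)
  let ?n = "length xs"
  assume "xs ! i \<noteq> i"
  with incr_nth_ge[OF incr, of i] i len have gt: "xs ! i \<ge> Suc i" by simp
  have ge: "Suc l \<le> xs ! l" if "i \<le> l" "l < ?n" for l
    using that
  proof (induction l rule: dec_induct)
    case (step l)
    moreover have "xs ! l < xs ! Suc l" using incr step by (auto simp: sorted_wrt_iff_nth_less)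
    ultimately show ?case by simp
  qed (use gt in simp)
  have "(\<Sum>l<?n. l) + (?n - i) = (\<Sum>l<?n. l + (if l \<ge> i then 1 else 0))"
  proof -
    have "{..<?n} \<inter> {l. i \<le> l} = {i..<?n}" by auto
    thus ?thesis by (simp add: sum.distrib sum.If_cases)
  qed
  also have "\<dots> \<le> (\<Sum>l<?n. xs ! l)"
    using ge incr_nth_ge[OF incr] by (intro sum_mono) auto
  also have "\<dots> = sum_list xs" by (simp add: sum_list_sum_nth atLeast0LessThan)
  finally show False using sum len i by simp
qed

text \<open>A nonzero Leibniz term would pair every row \<open>b\<close> with a column at least
  \<open>b\<close>, contrary to the sums. So an operator that only lowers levels cannot raise the
  degree.\<close>

lemma minor_upper_triangular_eq_0:
  assumes X: "\<And>b c. c < b \<Longrightarrow> X b c = 0"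
    and len: "length cs = length bs" and sum: "sum_list cs < sum_list bs"
  shows "minor X bs cs = 0"
  unfolding minor_leibniz
proof (intro sum.neutral ballI)
  fix p assume "p \<in> {p. p permutes {0..<length bs}}"
  hence p: "p permutes {0..<length bs}" by simp
  have "\<exists>i\<in>{0..<length bs}. cs ! p i < bs ! i"
  proof (rule ccontr)
    assume "\<not> ?thesis"
    hence "(\<Sum>i = 0..<length bs. bs ! i) \<le> (\<Sum>i = 0..<length bs. cs ! p i)"
      by (intro sum_mono) (meson not_less)
    also have "\<dots> = (\<Sum>i = 0..<length bs. cs ! i)"
      using sum.permute[OF p, of "(!) cs"] by (simp add: o_def)
    finally show False using sum len by (simp add: sum_list_sum_nth)
  qed
  hence "(\<Prod>i = 0..<length bs. X (bs ! i) (cs ! p i)) = 0"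
    using X by (intro prod_zero) auto
  thus "signof p * (\<Prod>i = 0..<length bs. X (bs ! i) (cs ! p i)) = 0" by simp
qed

definition toeplitz :: "(nat \<Rightarrow> 'a::comm_ring_1) \<Rightarrow> nat \<Rightarrow> nat \<Rightarrow> 'a" where
  "toeplitz f a c = (if c \<le> a then f (a - c) else 0)"

text \<open>Let \<open>S\<close> shift a one-particle state up, let \<open>S*\<close> be its adjoint, and let \<open>A\<close> be the matrix
  \<open>toeplitz f\<close>, a power series in \<open>S\<close>. The next three definitions give the matrices of
  \<open>(1 - S*)^j A\<close>, \<open>A (1 - S*)^j\<close> and \<open>(1 - S*)^j\<close>. The first two differ because
  \<open>S*\<close> kills the lowest state.\<close>
fun lower_after :: "(nat \<Rightarrow> 'a::comm_ring_1) \<Rightarrow> nat \<Rightarrow> nat \<Rightarrow> nat \<Rightarrow> 'a" where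
  "lower_after f 0 a c = toeplitz f a c"
| "lower_after f (Suc j) a c = lower_after f j a c - lower_after f j (Suc a) c"

fun lower_before :: "(nat \<Rightarrow> 'a::comm_ring_1) \<Rightarrow> nat \<Rightarrow> nat \<Rightarrow> nat \<Rightarrow> 'a" where
  "lower_before f 0 a c = toeplitz f a c"
| "lower_before f (Suc j) a c =
     lower_before f j a c - (if c = 0 then 0 else lower_before f j a (c - 1))"

definition lowering :: "nat \<Rightarrow> nat \<Rightarrow> nat \<Rightarrow> 'a::comm_ring_1" where
  "lowering j b c = (if b \<le> c then (-1) ^ (c - b) * of_nat (j choose (c - b)) else 0)"

lemma lowering_0: "lowering 0 b c = (if b = c then 1 else 0)"
  by (auto simp: lowering_def binomial_eq_0)

lemma lowering_Suc_0: "lowering (Suc 0) b c = (if b = c then 1 else 0) - (if Suc b = c then 1 else 0)"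
proof (cases "b \<le> c")
  case True
  then obtain d where "c = b + d" using le_Suc_ex by blast
  thus ?thesis
    by (cases d rule: nat.exhaust[case_product nat.exhaust, of _ d]; cases "d - 1")
       (auto simp: lowering_def binomial_eq_0)
qed (auto simp: lowering_def)

lemma lowering_Suc_row: "lowering (Suc j) a b = lowering j a b - lowering j (Suc a) b"
proof (cases "a < b")
  case True
  then obtain d where "b = a + Suc d" using less_imp_Suc_add by force
  thus ?thesis by (simp add: lowering_def algebra_simps)
qed (auto simp: lowering_def)

lemma lowering_Suc_col:
  "lowering (Suc j) b c = lowering j b c - (if c = 0 then 0 else lowering j b (c - 1))"
proof (cases "b < c")
  case True
  then obtain d where "c = b + Suc d" using less_imp_Suc_add by force
  thus ?thesis by (simp add: lowering_def algebra_simps)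
qed (auto simp: lowering_def)

lemma lower_after_eq_sum:
  assumes "a + j < L"
  shows "lower_after f j a c = (\<Sum>b<L. lowering j a b * toeplitz f b c)"
  using assms
proof (induction j arbitrary: a)
  case 0
  thus ?case by (simp add: lowering_0 if_distrib[of "\<lambda>x. x * _"] sum.delta cong: if_cong)
next
  case (Suc j)
  thus ?case by (simp add: lowering_Suc_row left_diff_distrib sum_subtractf)
qed

lemma lower_before_eq_sum:
  assumes "a < L"
  shows "lower_before f j a c = (\<Sum>b<L. toeplitz f a b * lowering j b c)"
proof (induction j arbitrary: c)
  case 0
  have "toeplitz f a c = (\<Sum>b<L. if b = c then toeplitz f a b else 0)"
    using assms by (simp add: sum.delta' toeplitz_def)
  thus ?case by (simp add: lowering_0 if_distrib[of "\<lambda>x. _ * x"] cong: if_cong)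
next
  case (Suc j)
  thus ?case by (simp add: lowering_Suc_col right_diff_distrib sum_subtractf)
qed

text \<open>Row differences keep a matrix constant along diagonals. Hence in every column except 0 a
  difference of rows is also a difference of columns.\<close>

lemma lower_after_toeplitz: "lower_after f j (Suc a) (Suc c) = lower_after f j a c"
  by (induction j arbitrary: a) (auto simp: toeplitz_def)

lemma mult_lowering_Suc_0:
  assumes "c < (L::nat)"
  shows "(\<Sum>b<L. X b * lowering (Suc 0) b c) = X c - (if c = 0 then 0 else X (c - 1))"
proof -
  have "(\<Sum>b<L. X b * lowering (Suc 0) b c) =
      (\<Sum>b<L. if b = c then X b else 0) - (\<Sum>b<L. if Suc b = c then X b else 0)"
    unfolding sum_subtractf[symmetric] lowering_Suc_0 by (intro sum.cong) auto
  also have "(\<Sum>b<L. if Suc b = c then X b else 0) = (if c = 0 then 0 else X (c - 1))"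
  proof (cases c)
    case (Suc d)
    thus ?thesis using assms by (simp add: sum.delta)
  qed simp
  finally show ?thesis using assms by (simp add: sum.delta)
qed

text \<open>With \<open>k m\<close> the entry in column \<open>m\<close>, a combination of columns
  is rewritten through column 0 and differences of neighbouring columns, which are the columns
  produced by lowering on the right.\<close>

lemma summation_by_parts:
  fixes \<epsilon> k :: "nat \<Rightarrow> 'a::comm_ring_1"
  assumes "0 < t"
  shows "(\<Sum>i\<le>t. \<epsilon> i) * k 0 + (\<Sum>m = 1..<t. (\<Sum>i = Suc m..t. \<epsilon> i) * (k m - k (m - 1))) =
    \<epsilon> 0 * k 0 + (\<Sum>m<t. \<epsilon> (Suc m) * k m)"
proof -
  define \<gamma> where "\<gamma> m = (\<Sum>i = m..t. \<epsilon> i)" for m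
  have \<gamma>: "\<gamma> m = \<epsilon> m + \<gamma> (Suc m)" if "m \<le> t" for m
    using that by (simp add: \<gamma>_def sum.atLeast_Suc_atMost)
  have *: "(\<Sum>m = 1..<Suc s. \<gamma> (Suc m) * (k m - k (m - 1))) + \<gamma> 1 * k 0 =
    (\<Sum>m<Suc s. \<epsilon> (Suc m) * k m) + \<gamma> (Suc (Suc s)) * k s" if "s < t" for s
    using that
  proof (induction s)
    case 0
    thus ?case using \<gamma>[of 1] by (simp add: algebra_simps)
  next
    case (Suc s)
    have "(\<Sum>m = 1..<Suc (Suc s). \<gamma> (Suc m) * (k m - k (m - 1))) + \<gamma> 1 * k 0 =
       (\<Sum>m = 1..<Suc s. \<gamma> (Suc m) * (k m - k (m - 1))) + \<gamma> 1 * k 0 +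
       \<gamma> (Suc (Suc s)) * (k (Suc s) - k s)" by simp
    also have "\<dots> = (\<Sum>m<Suc s. \<epsilon> (Suc m) * k m) + \<gamma> (Suc (Suc s)) * k (Suc s)"
      using Suc by (simp add: algebra_simps)
    finally show ?case using \<gamma>[of "Suc (Suc s)"] Suc.prems by (simp add: algebra_simps)
  qed
  have "\<gamma> (Suc t) = 0" by (simp add: \<gamma>_def)
  moreover have "(\<Sum>i\<le>t. \<epsilon> i) = \<epsilon> 0 + \<gamma> 1"
    using \<gamma>[of 0] by (simp add: \<gamma>_def atMost_atLeast0)
  ultimately show ?thesis
    using *[of "t - 1"] assms by (simp add: \<gamma>_def[symmetric] algebra_simps)
qed

text \<open>The recurrence combines columns, so it survives row differences. These only involve
  larger rows and so stay away from row 0, where it may fail.\<close>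

lemma lower_after_relation:
  assumes "\<And>a. (\<Sum>i\<le>t. \<epsilon> i * toeplitz f (Suc a) i) = 0"
  shows "(\<Sum>i\<le>t. \<epsilon> i * lower_after f j (Suc a) i) = 0"
  using assms by (induction j arbitrary: a) (simp_all add: right_diff_distrib sum_subtractf)

text \<open>The recurrence in row \<open>Suc a\<close>, shifted along the diagonals, expresses the
  entry in column 0 through the columns \<open>0, ..., t - 1\<close> of row \<open>a\<close>;
  summation by parts gives it the form of a column operation.\<close>

lemma lower_after_Suc_col_0:
  assumes rel: "\<And>a. (\<Sum>i\<le>t. \<epsilon> i * toeplitz f (Suc a) i) = 0" and "\<epsilon> 0 = 1" "0 < t"
  shows "lower_after f (Suc j) a 0 = (\<Sum>i\<le>t. \<epsilon> i) * lower_after f j a 0 +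
    (\<Sum>m = 1..<t. (\<Sum>i = Suc m..t. \<epsilon> i) * (lower_after f j a m - lower_after f j a (m - 1)))"
proof -
  have "0 = (\<Sum>i<Suc t. \<epsilon> i * lower_after f j (Suc a) i)"
    using lower_after_relation[OF rel, of j a] by (simp add: lessThan_Suc_atMost)
  also have "\<dots> = lower_after f j (Suc a) 0 + (\<Sum>i<t. \<epsilon> (Suc i) * lower_after f j a i)"
    unfolding sum.lessThan_Suc_shift using assms by (simp add: lower_after_toeplitz)
  finally show ?thesis
    unfolding summation_by_parts[OF \<open>0 < t\<close>] using assms(2)
    by (simp add: algebra_simps eq_neg_iff_add_eq_0)
qed

text \<open>For \<open>S* A\<close> versus \<open>A S*\<close> only column 0 changes. Once the columns \<open>0, \<dots>, t - 1\<close> are all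
  present, the linear recurrence satisfied by \<open>f\<close> turns this change into a column operation.\<close>
lemma minor_lower_after_Suc:
  fixes f :: "nat \<Rightarrow> 'a::comm_ring_1"
  assumes rel: "\<And>a. (\<Sum>i\<le>t. \<epsilon> i * toeplitz f (Suc a) i) = 0" and \<epsilon>: "\<epsilon> 0 = 1" and t: "0 < t"
    and len: "length cs = length as" "t \<le> length cs"
    and low: "\<And>i. i < t \<Longrightarrow> cs ! i = i" and incr: "sorted_wrt (<) cs"
  shows "minor (lower_after f (Suc j)) as cs = (\<Sum>i\<le>t. \<epsilon> i) *
    minor (\<lambda>a c. lower_after f j a c - (if c = 0 then 0 else lower_after f j a (c - 1))) as cs"
proof -
  let ?n = "length as"
  define Y where "Y a c = lower_after f j a c - (if c = 0 then 0 else lower_after f j a (c - 1))" for a c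
  define A where "A = mat ?n ?n (\<lambda>(i, l). lower_after f (Suc j) (as ! i) (cs ! l))"
  define B where "B = mat ?n ?n (\<lambda>(i, l). Y (as ! i) (cs ! l))"
  \<comment> \<open>Right multiplication by \<open>U\<close> changes only column 0, with the
    coefficients from \<open>lower_after_Suc_col_0\<close>. \<open>U\<close> is lower triangular,
    with the sum of all \<open>\<epsilon> i\<close> in the corner and ones on the rest of the
    diagonal.\<close>
  define U where "U = mat ?n ?n (\<lambda>(i, l). if l = 0 then (if i = 0 then (\<Sum>i\<le>t. \<epsilon> i) else
     if i < t then (\<Sum>i = Suc i..t. \<epsilon> i) else 0) else if i = l then 1 else 0)"
  have pos: "cs ! l \<noteq> 0" if "0 < l" "l < ?n" for l
    using incr_nth_ge[OF incr, of l] that len by simp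
  have n0: "0 < ?n" using t len by linarith
  have "A = B * U"
  proof (rule eq_matI)
    fix i l assume il: "i < dim_row (B * U)" "l < dim_col (B * U)"
    hence [simp]: "i < ?n" "l < ?n" by (auto simp: B_def U_def)
    have "(B * U) $$ (i, l) = (\<Sum>m = 0..<?n. Y (as ! i) (cs ! m) * U $$ (m, l))"
      by (simp add: B_def U_def scalar_prod_def)
    also have "\<dots> = lower_after f (Suc j) (as ! i) (cs ! l)"
    proof (cases "l = 0")
      case False
      hence "(\<Sum>m = 0..<?n. Y (as ! i) (cs ! m) * U $$ (m, l)) =
          (\<Sum>m = 0..<?n. if m = l then Y (as ! i) (cs ! m) else 0)"
        by (intro sum.cong) (auto simp: U_def)
      also have "\<dots> = Y (as ! i) (cs ! l)" by (simp add: sum.delta)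
      also have "\<dots> = lower_after f (Suc j) (as ! i) (cs ! l)"
        using pos[of l] False lower_after_toeplitz[of f j "as ! i" "cs ! l - 1"] by (simp add: Y_def)
      finally show ?thesis .
    next
      case True
      have "(\<Sum>m = 0..<?n. Y (as ! i) (cs ! m) * U $$ (m, l)) =
          (\<Sum>m = 0..<t. Y (as ! i) (cs ! m) * U $$ (m, 0))"
        using len True t n0 by (intro sum.mono_neutral_cong_right) (auto simp: U_def)
      also have "\<dots> = Y (as ! i) (cs ! 0) * U $$ (0, 0) +
          (\<Sum>m = 1..<t. Y (as ! i) (cs ! m) * U $$ (m, 0))"
        using t by (simp add: sum.atLeast_Suc_lessThan)
      also have "(\<Sum>m = 1..<t. Y (as ! i) (cs ! m) * U $$ (m, 0)) =
          (\<Sum>m = 1..<t. (\<Sum>i = Suc m..t. \<epsilon> i) * (lower_after f j (as ! i) m - lower_after f j (as ! i) (m - 1)))"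
        using len low n0 by (intro sum.cong) (auto simp: U_def Y_def mult.commute)
      also have "Y (as ! i) (cs ! 0) * U $$ (0, 0) = (\<Sum>i\<le>t. \<epsilon> i) * lower_after f j (as ! i) 0"
        using t n0 low[of 0] by (simp add: U_def Y_def)
      finally show ?thesis
        unfolding True low[OF t] lower_after_Suc_col_0[OF rel \<epsilon> t] .
    qed
    finally show "A $$ (i, l) = (B * U) $$ (i, l)" by (simp add: A_def)
  qed (auto simp: A_def B_def U_def)
  hence "det A = det B * det U" by (simp add: det_mult[of _ ?n] B_def U_def)
  also have "det U = prod_list (diag_mat U)"
    by (rule det_lower_triangular[where n = ?n]) (auto simp: U_def)
  also have "\<dots> = (\<Prod>i = 0..<?n. if i = 0 then (\<Sum>i\<le>t. \<epsilon> i) else 1)"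
    unfolding prod_list_diag_prod by (intro prod.cong) (auto simp: U_def)
  also have "\<dots> = (\<Sum>i\<le>t. \<epsilon> i)" using n0 by (simp add: prod.delta)
  finally show ?thesis by (simp add: A_def B_def Y_def minor_def mult_ac)
qed

text \<open>The lowering factors are moved across one at a time, each contributing the sum of all
  \<open>\<epsilon> i\<close>. Cauchy--Binet then splits the moved factor off on the right; it only
  leads to \<open>bs\<close> of degree at most that of \<open>cs\<close>, to which the induction
  hypothesis applies.\<close>

lemma minor_lower_after_eq_lower_before:
  fixes f :: "nat \<Rightarrow> 'a::comm_ring_1"
  assumes rel: "\<And>a. (\<Sum>i\<le>t. \<epsilon> i * toeplitz f (Suc a) i) = 0" and \<epsilon>: "\<epsilon> 0 = 1" and t: "0 < t"
    and len: "length cs = length as" "k + t \<le> length cs"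
    and incr: "sorted_wrt (<) cs" and low: "sum_list cs \<le> (\<Sum>i<length cs. i) + k"
  shows "minor (lower_after f j) as cs = (\<Sum>i\<le>t. \<epsilon> i) ^ j * minor (lower_before f j) as cs"
  using len incr low
proof (induction j arbitrary: cs)
  case 0
  show ?case by (simp add: minor_def)
next
  case (Suc j)
  define n where "n = length as"
  define L where "L = Suc (Max (insert 0 (set cs)))"
  have L: "c < L" if "c \<in> set cs" for c using that by (auto simp: L_def less_Suc_eq_le)
  let ?\<theta> = "\<Sum>i\<le>t. \<epsilon> i"
  have len: "length as = n" "length cs = n" using Suc.prems by (auto simp: n_def)
  have "minor (lower_after f (Suc j)) as cs = ?\<theta> *
      minor (\<lambda>a c. lower_after f j a c - (if c = 0 then 0 else lower_after f j a (c - 1))) as cs"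
    using Suc.prems by (intro minor_lower_after_Suc rel \<epsilon> t) (auto intro: incr_nth_eq)
  also have "minor (\<lambda>a c. lower_after f j a c - (if c = 0 then 0 else lower_after f j a (c - 1))) as cs =
      (\<Sum>bs\<in>incr_lists n {..<L}. minor (lower_after f j) as bs * minor (lowering (Suc 0)) bs cs)"
    by (rule Cauchy_Binet) (simp_all add: len L mult_lowering_Suc_0)
  also have "\<dots> = (\<Sum>bs\<in>incr_lists n {..<L}.
      ?\<theta> ^ j * minor (lower_before f j) as bs * minor (lowering (Suc 0)) bs cs)"
  proof (intro sum.cong refl)
    fix bs assume bs: "bs \<in> incr_lists n {..<L}"
    show "minor (lower_after f j) as bs * minor (lowering (Suc 0)) bs cs =
      ?\<theta> ^ j * minor (lower_before f j) as bs * minor (lowering (Suc 0)) bs cs"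
    proof (cases "sum_list cs < sum_list bs")
      case True
      hence "minor (lowering (Suc 0)) bs cs = (0::'a)"
        using bs len by (intro minor_upper_triangular_eq_0) (auto simp: lowering_def incr_lists_def)
      thus ?thesis by simp
    next
      case False
      thus ?thesis using bs Suc.prems len by (subst Suc.IH) (auto simp: incr_lists_def)
    qed
  qed
  also have "\<dots> = ?\<theta> ^ j *
      (\<Sum>bs\<in>incr_lists n {..<L}. minor (lower_before f j) as bs * minor (lowering (Suc 0)) bs cs)"
    by (simp add: sum_distrib_left mult_ac)
  also have "(\<Sum>bs\<in>incr_lists n {..<L}. minor (lower_before f j) as bs * minor (lowering (Suc 0)) bs cs) =
      minor (lower_before f (Suc j)) as cs"
    by (rule Cauchy_Binet[symmetric]) (simp_all add: len L mult_lowering_Suc_0)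
  finally show ?case by (simp only: power_Suc mult.assoc)
qed

section \<open>Graded traces\<close>

lemma minor_hom:
  assumes "comm_ring_hom h"
  shows "minor (\<lambda>a b. h (X a b)) xs ys = h (minor X xs ys)"
proof -
  interpret comm_ring_hom h by fact
  show ?thesis
    unfolding minor_def hom_det[symmetric] by (intro arg_cong[where f = det] eq_matI) auto
qed

text \<open>The coefficient of \<open>x^n\<close> in \<open>(1 - x)^(-s)\<close>.\<close>

definition rising :: "'a::field_char_0 \<Rightarrow> nat \<Rightarrow> 'a" where
  "rising s n = pochhammer s n / fact n"

lemma rising_0 [simp]: "rising s 0 = 1"
  by (simp add: rising_def)

lemma rising_zero: "rising 0 n = (if n = 0 then 1 else 0)"
  by (simp add: rising_def pochhammer_0_left)

lemma rising_add: "rising (s + u) n = (\<Sum>i\<le>n. rising s i * rising u (n - i))"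
proof -
  have "rising (s + u) n =
      (\<Sum>i\<le>n. of_nat (n choose i) * pochhammer s i * pochhammer u (n - i) / fact n)"
    unfolding rising_def pochhammer_binomial_sum sum_divide_distrib ..
  also have "\<dots> = (\<Sum>i\<le>n. rising s i * rising u (n - i))"
    by (intro sum.cong) (auto simp: rising_def binomial_fact field_simps)
  finally show ?thesis .
qed

lemma rising_minus_of_nat: "rising (- of_nat t) n = (-1) ^ n * of_nat (t choose n)"
proof -
  have "of_nat (t choose n) = (-1) ^ n * rising (- of_nat t :: 'a) n"
    by (simp add: binomial_gbinomial gbinomial_pochhammer rising_def)
  thus ?thesis by (simp flip: power_mult_distrib)
qed

text \<open>The coefficient of \<open>S^n\<close> in \<open>(1 - xS)^(-t)\<close>, where
  \<open>x\<close> is the polynomial variable.\<close>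

definition rising_monom :: "nat \<Rightarrow> nat \<Rightarrow> 'a::field_char_0 poly" where
  "rising_monom t n = monom (rising (of_nat t) n) n"

text \<open>The product of \<open>(1 - xS)^t\<close> and \<open>(1 - xS)^(-t)\<close> is 1, so its
  coefficient at \<open>S^(Suc a)\<close> vanishes. This is the recurrence behind the commutation
  rule.\<close>

lemma toeplitz_relation:
  "(\<Sum>i\<le>t. monom ((-1) ^ i * of_nat (t choose i)) i * toeplitz (rising_monom t) (Suc a) i) =
   (0 :: 'a::field_char_0 poly)"
proof -
  let ?g = "\<lambda>i. (-1) ^ i * of_nat (t choose i) * rising (of_nat t) (Suc a - i) :: 'a"
  have "(\<Sum>i\<le>t. monom ((-1) ^ i * of_nat (t choose i)) i * toeplitz (rising_monom t) (Suc a) i) =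
      (\<Sum>i\<in>{..t} \<inter> {..Suc a}. monom (?g i) (Suc a))"
    by (intro sum.mono_neutral_cong_right)
       (auto simp: toeplitz_def rising_monom_def mult_monom)
  also have "\<dots> = (\<Sum>i\<le>Suc a. monom (?g i) (Suc a))"
    by (intro sum.mono_neutral_left) (auto simp: binomial_eq_0)
  also have "\<dots> = monom (\<Sum>i\<le>Suc a. ?g i) (Suc a)"
    by (rule poly_eqI) (simp add: coeff_sum)
  also have "(\<Sum>i\<le>Suc a. ?g i) = 0"
    using rising_add[of "- of_nat t :: 'a" "of_nat t" "Suc a"]
    by (simp add: rising_minus_of_nat rising_zero)
  finally show ?thesis by simp
qed

lemma sum_monom_binomial:
  "(\<Sum>i\<le>t. monom ((-1) ^ i * of_nat (t choose i)) i) = ([:1, -1:] :: 'a::comm_ring_1 poly) ^ t"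
proof -
  have "[:1, -1:] = (monom (-1) 1 + 1 :: 'a poly)" by (simp add: monom_altdef one_pCons)
  hence "([:1, -1:] :: 'a poly) ^ t = (\<Sum>i\<le>t. of_nat (t choose i) * monom (-1) 1 ^ i)"
    by (simp add: binomial_ring)
  also have "\<dots> = (\<Sum>i\<le>t. monom ((-1) ^ i * of_nat (t choose i)) i)"
    by (intro sum.cong refl) (simp add: monom_power of_nat_poly smult_monom mult.commute)
  finally show ?thesis ..
qed

section \<open>Degrees of basis vectors and homogeneity of Toeplitz minors\<close>

definition incr_sum :: "nat \<Rightarrow> nat \<Rightarrow> nat list set" where
  "incr_sum n d = {xs. length xs = n \<and> sorted_wrt (<) xs \<and> sum_list xs = d}"

lemma incr_sum_eq: "d < L \<Longrightarrow> incr_sum n d = {xs \<in> incr_lists n {..<L}. sum_list xs = d}"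
  by (auto simp: incr_sum_def incr_lists_def dest: member_le_sum_list)

lemma finite_incr_sum: "finite (incr_sum n d)"
  by (subst incr_sum_eq[of d "Suc d"]) (auto intro!: finite_incr_lists)

lemma incr_sum_empty:
  assumes "d < (\<Sum>i<n. i)"
  shows "incr_sum n d = {}"
proof -
  have "(\<Sum>i<n. i) \<le> d" if "xs \<in> incr_sum n d" for xs
  proof -
    have xs: "length xs = n" "sorted_wrt (<) xs" "sum_list xs = d"
      using that by (auto simp: incr_sum_def)
    have "(\<Sum>i<n. i) \<le> (\<Sum>i<n. xs ! i)" using xs by (intro sum_mono incr_nth_ge) auto
    also have "\<dots> = d" using xs by (simp add: sum_list_sum_nth atLeast0LessThan)
    finally show ?thesis .
  qed
  thus ?thesis using assms by force
qed

lemma coeff_prod_toeplitz_monom: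
  fixes g :: "nat \<Rightarrow> 'a::comm_ring_1"
  assumes "finite I"
  shows "coeff (\<Prod>i\<in>I. toeplitz (\<lambda>n. monom (g n) n) (a i) (b i)) r =
    (if sum a I = sum b I + r then \<Prod>i\<in>I. toeplitz g (a i) (b i) else 0)"
  using assms
proof (induction I arbitrary: r)
  case (insert i I)
  show ?case
  proof (cases "b i \<le> a i")
    case True
    let ?P = "\<Prod>i\<in>I. toeplitz (\<lambda>n. monom (g n) n) (a i) (b i)"
    have "coeff (\<Prod>i\<in>insert i I. toeplitz (\<lambda>n. monom (g n) n) (a i) (b i)) r =
        coeff (monom (g (a i - b i)) (a i - b i) * ?P) r"
      using insert True by (simp add: toeplitz_def)
    also have "\<dots> = (if r < a i - b i then 0 else g (a i - b i) * coeff ?P (r - (a i - b i)))"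
      by (simp add: coeff_monom_mult)
    also have "\<dots> = (if sum a (insert i I) = sum b (insert i I) + r
        then \<Prod>i\<in>insert i I. toeplitz g (a i) (b i) else 0)"
    proof (cases "r < a i - b i")
      case r: True
      show ?thesis
      proof (cases "sum b I \<le> sum a I")
        case True
        thus ?thesis using r insert by auto
      next
        \<comment> \<open>The columns now have the larger sum, so some factor lies above the
          diagonal and vanishes.\<close>
        case False
        hence "\<not> (\<forall>i\<in>I. b i \<le> a i)" using sum_mono[of I b a] by auto
        hence "(\<Prod>i\<in>I. toeplitz g (a i) (b i)) = 0"
          using insert by (intro prod_zero) (auto simp: toeplitz_def)
        thus ?thesis using r insert by simp
      qed
    qed (use insert True in \<open>auto simp: toeplitz_def\<close>)
    finally show ?thesis .
  qed (use insert in \<open>simp add: toeplitz_def\<close>)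
qed auto

text \<open>All nonzero Leibniz terms have the same degree in \<open>x\<close>, the difference of
  the two sums. So \<open>x\<close> records by how much the degree is raised.\<close>

lemma coeff_minor_toeplitz_monom:
  fixes g :: "nat \<Rightarrow> 'a::comm_ring_1"
  assumes len: "length ys = length xs"
  shows "coeff (minor (toeplitz (\<lambda>n. monom (g n) n)) xs ys) r =
    (if sum_list xs = sum_list ys + r then minor (toeplitz g) xs ys else 0)"
proof -
  let ?n = "length xs"
  have "coeff (signof p * (\<Prod>i = 0..<?n. toeplitz (\<lambda>n. monom (g n) n) (xs ! i) (ys ! p i))) r =
     signof p * (if sum_list xs = sum_list ys + r
       then \<Prod>i = 0..<?n. toeplitz g (xs ! i) (ys ! p i) else 0)" if p: "p permutes {0..<?n}" for p
  proof -
    have "(\<Sum>i = 0..<?n. ys ! p i) = sum_list ys"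
      using sum.permute[OF p, of "(!) ys"] len by (simp add: o_def sum_list_sum_nth)
    thus ?thesis
      by (simp add: of_int_poly coeff_prod_toeplitz_monom sum_list_sum_nth)
  qed
  thus ?thesis unfolding minor_leibniz coeff_sum by (auto intro!: sum.cong sum.neutral)
qed

lemma comm_ring_hom_const_poly: "comm_ring_hom (\<lambda>c. [:c:])"
  by unfold_locales (auto simp: one_pCons)

lemma comm_ring_hom_poly: "comm_ring_hom (\<lambda>p. poly p (x :: 'a::comm_ring_1))"
  by unfold_locales auto

lemma minor_lowering_poly:
  "minor (lowering j) xs ys = [:minor (lowering j) xs ys :: 'a::comm_ring_1:]"
proof -
  interpret h: comm_ring_hom "\<lambda>c :: 'a. [:c:]" by (rule comm_ring_hom_const_poly)
  have "lowering j = (\<lambda>b c. [:lowering j b c:] :: 'a poly)"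
    by (simp add: lowering_def fun_eq_iff h.hom_mult h.hom_power h.hom_uminus h.hom_one of_nat_poly)
  thus ?thesis using minor_hom[OF comm_ring_hom_const_poly, where X = "lowering j"] by simp
qed

text \<open>The trace in degree \<open>d\<close> on the \<open>n\<close>-th exterior power, where
  lowering acts first and \<open>(1 - xS)^(-t)\<close> raises afterwards; \<open>trace_after\<close>
  has the opposite order.\<close>

definition trace_before :: "nat \<Rightarrow> nat \<Rightarrow> nat \<Rightarrow> 'a::field_char_0 poly" where
  "trace_before n t d = (\<Sum>xs\<in>incr_sum n d. minor (lower_before (rising_monom t) t) xs xs)"

definition trace_after :: "nat \<Rightarrow> nat \<Rightarrow> nat \<Rightarrow> 'a::field_char_0 poly" where
  "trace_after n t d = (\<Sum>xs\<in>incr_sum n d. minor (lower_after (rising_monom t) t) xs xs)"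

text \<open>Cauchy--Binet passes through intermediate vectors \<open>ys\<close>. Raising by
  \<open>r\<close> has to lead back to degree \<open>d\<close>, which fixes the degree of
  \<open>ys\<close>.\<close>

lemma coeff_minor_lower_before:
  assumes xs: "xs \<in> incr_sum n d"
  shows "coeff (minor (lower_before (rising_monom t) t) xs xs) r =
    (\<Sum>ys | ys \<in> incr_lists n {..d} \<and> sum_list ys + r = d.
       minor (toeplitz (rising (of_nat t :: 'a::field_char_0))) xs ys * minor (lowering t) ys xs)"
proof -
  have len: "length xs = n" and sum: "sum_list xs = d" using xs by (auto simp: incr_sum_def)
  have le: "x \<le> d" if "x \<in> set xs" for x using sum member_le_sum_list[OF that] by simp
  have "minor (lower_before (rising_monom t) t) xs xs = (\<Sum>ys\<in>incr_lists n {..d}.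
      minor (toeplitz (rising_monom t)) xs ys * (minor (lowering t) ys xs :: 'a poly))"
    using le lower_before_eq_sum[where L = "Suc d" and f = "rising_monom t :: nat \<Rightarrow> 'a poly" and j = t]
    by (intro Cauchy_Binet) (simp_all add: len lessThan_Suc_atMost less_Suc_eq_le)
  hence "coeff (minor (lower_before (rising_monom t) t) xs xs) r = (\<Sum>ys\<in>incr_lists n {..d}.
      coeff (minor (toeplitz (rising_monom t)) xs ys) r * minor (lowering t) ys xs :: 'a)"
    by (simp add: coeff_sum minor_lowering_poly mult.commute)
  also have "\<dots> = (\<Sum>ys\<in>incr_lists n {..d}. if sum_list ys + r = d
      then minor (toeplitz (rising (of_nat t))) xs ys * minor (lowering t) ys xs else 0)"
    unfolding rising_monom_def[abs_def]
    by (intro sum.cong) (auto simp: coeff_minor_toeplitz_monom len sum incr_lists_def)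
  also have "\<dots> = (\<Sum>ys | ys \<in> incr_lists n {..d} \<and> sum_list ys + r = d.
       minor (toeplitz (rising (of_nat t))) xs ys * minor (lowering t) ys xs)"
    by (simp add: sum.inter_filter finite_incr_lists)
  finally show ?thesis .
qed

lemma coeff_trace_before:
  "coeff (trace_before n t (d + r)) r = (\<Sum>xs\<in>incr_sum n (d + r). \<Sum>ys\<in>incr_sum n d.
     minor (toeplitz (rising (of_nat t :: 'a::field_char_0))) xs ys * minor (lowering t) ys xs)"
proof -
  have "{ys. ys \<in> incr_lists n {..d + r} \<and> sum_list ys + r = d + r} = incr_sum n d"
    by (subst incr_sum_eq[of d "Suc (d + r)"]) (auto simp: lessThan_Suc_atMost)
  thus ?thesis by (simp add: trace_before_def coeff_sum coeff_minor_lower_before)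
qed

text \<open>An intermediate vector of degree \<open>d - r\<close> would lie below the lowest
  degree.\<close>

lemma coeff_trace_before_eq_0:
  assumes "d < (\<Sum>i<n. i) + r"
  shows "coeff (trace_before n t d) r = 0"
proof (cases "r \<le> d")
  case True
  thus ?thesis using coeff_trace_before[of n t "d - r" r] incr_sum_empty[of "d - r" n] assms by simp
next
  case False
  thus ?thesis by (simp add: trace_before_def coeff_sum coeff_minor_lower_before)
qed

lemma coeff_minor_lower_after:
  assumes ys: "ys \<in> incr_sum n d"
  shows "coeff (minor (lower_after (rising_monom t) t) ys ys) r =
    (\<Sum>xs\<in>incr_sum n (d + r). minor (lowering t) ys xs *
       minor (toeplitz (rising (of_nat t :: 'a::field_char_0))) xs ys)"
proof -
  \<comment> \<open>\<open>d + t\<close> bounds the indices reached by \<open>lowering t\<close>,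
    and \<open>d + r\<close> those in vectors of degree \<open>d + r\<close>.\<close>
  define L where "L = Suc (d + t + r)"
  have len: "length ys = n" and sum: "sum_list ys = d" using ys by (auto simp: incr_sum_def)
  have le: "y \<le> d" if "y \<in> set ys" for y using sum member_le_sum_list[OF that] by simp
  have "minor (lower_after (rising_monom t) t) ys ys = (\<Sum>xs\<in>incr_lists n {..<L}.
      minor (lowering t) ys xs * (minor (toeplitz (rising_monom t)) xs ys :: 'a poly))"
    using le by (intro Cauchy_Binet lower_after_eq_sum) (auto simp: len L_def less_Suc_eq_le intro!: trans_le_add1)
  hence "coeff (minor (lower_after (rising_monom t) t) ys ys) r = (\<Sum>xs\<in>incr_lists n {..<L}.
      minor (lowering t) ys xs * coeff (minor (toeplitz (rising_monom t)) xs ys) r :: 'a)"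
    by (simp add: coeff_sum minor_lowering_poly)
  also have "\<dots> = (\<Sum>xs\<in>incr_lists n {..<L}. if sum_list xs = d + r
      then minor (lowering t) ys xs * minor (toeplitz (rising (of_nat t))) xs ys else 0)"
    unfolding rising_monom_def[abs_def]
    by (intro sum.cong) (auto simp: coeff_minor_toeplitz_monom len sum incr_lists_def)
  also have "\<dots> = (\<Sum>xs\<in>incr_sum n (d + r).
      minor (lowering t) ys xs * minor (toeplitz (rising (of_nat t))) xs ys)"
    by (subst incr_sum_eq[of _ L]) (auto simp: L_def sum.inter_filter finite_incr_lists)
  finally show ?thesis .
qed

text \<open>Cyclicity of the trace, degree by degree.\<close>
lemma coeff_trace_after: "coeff (trace_after n t d) r = coeff (trace_before n t (d + r)) r"
  unfolding coeff_trace_before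
  by (subst sum.swap) (simp add: trace_after_def coeff_sum coeff_minor_lower_after mult.commute)

text \<open>The recurrence coefficients sum to \<open>(1 - x)^t\<close>, and \<open>t\<close>
  lowering factors are moved, whence the exponent \<open>t * t\<close>.\<close>

lemma trace_after_eq:
  assumes "0 < t" "k + t \<le> n" "d \<le> (\<Sum>i<n. i) + k"
  shows "trace_after n t d = [:1, -1:] ^ (t * t) * trace_before n t d"
proof -
  have "minor (lower_after (rising_monom t) t) xs xs =
      [:1, -1:] ^ (t * t) * minor (lower_before (rising_monom t :: nat \<Rightarrow> 'a poly) t) xs xs"
    if "xs \<in> incr_sum n d" for xs
    using minor_lower_after_eq_lower_before[OF toeplitz_relation, where as = xs and cs = xs and k = k and j = t]
      that assms by (simp add: incr_sum_def sum_monom_binomial power_mult)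
  thus ?thesis by (simp add: trace_after_def trace_before_def sum_distrib_left)
qed

lemma poly_lower_before: "poly (lower_before f j a c) x = lower_before (\<lambda>n. poly (f n) x) j a c"
  by (induction j arbitrary: c) (auto simp: toeplitz_def)

lemma poly_minor_lower_before:
  "poly (minor (lower_before f j) xs ys) x = minor (lower_before (\<lambda>n. poly (f n) x) j) xs ys"
  using minor_hom[OF comm_ring_hom_poly, where X = "lower_before f j"] by (simp add: poly_lower_before)

lemma poly_trace_before_1:
  "poly (trace_before n t d) 1 =
   (\<Sum>xs\<in>incr_sum n d. minor (lower_before (rising (of_nat t)) t) xs xs)"
  by (simp add: trace_before_def poly_sum poly_minor_lower_before rising_monom_def poly_monom)

lemma minor_lowering_self:
  assumes "sorted_wrt (<) xs"
  shows "minor (lowering j) xs xs = 1"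
proof -
  let ?n = "length xs"
  let ?A = "mat ?n ?n (\<lambda>(i, l). lowering j (xs ! i) (xs ! l))"
  have "xs ! l < xs ! i" if "l < i" "i < ?n" for i l
    using assms that by (auto simp: sorted_wrt_iff_nth_less)
  hence "det ?A = prod_list (diag_mat ?A)"
    by (intro det_upper_triangular[of _ ?n]) (force simp: upper_triangular_def lowering_def)+
  also have "\<dots> = 1" by (simp add: prod_list_diag_prod lowering_def)
  finally show ?thesis by (simp add: minor_def)
qed

text \<open>At \<open>x = 0\<close> only the unitriangular lowering matrix remains, so every
  diagonal minor is 1 and the trace counts basis vectors.\<close>

lemma coeff_trace_before_0: "coeff (trace_before n t d) 0 = of_nat (card (incr_sum n d))"
proof -
  have "lower_before (\<lambda>n. poly (rising_monom t n) 0) t = (lowering t :: nat \<Rightarrow> nat \<Rightarrow> 'a)"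
  proof (intro ext)
    fix a c
    have "lower_before (\<lambda>n. poly (rising_monom t n) (0::'a)) t a c =
        (\<Sum>b<Suc a. if b = a then lowering t b c else 0)"
      unfolding lower_before_eq_sum[OF lessI]
      by (intro sum.cong) (auto simp: toeplitz_def rising_monom_def poly_monom)
    thus "lower_before (\<lambda>n. poly (rising_monom t n) (0::'a)) t a c = lowering t a c"
      by (simp add: sum.delta)
  qed
  hence "coeff (minor (lower_before (rising_monom t) t) xs xs) 0 = (1::'a)" if "xs \<in> incr_sum n d" for xs
    using that minor_lowering_self[of xs t] poly_minor_lower_before[of "rising_monom t" t xs xs "0::'a"]
    by (simp add: incr_sum_def poly_0_coeff_0)
  thus ?thesis by (simp add: trace_before_def coeff_sum)
qed

section \<open>The functional equation of the trace\<close>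

unbundle no vec_syntax
no_notation vec_index (infixl "$" 100)
unbundle fps_syntax

lemma comm_ring_hom_fps_const: "comm_ring_hom (fps_const :: 'a::comm_ring_1 \<Rightarrow> 'a fps)"
  by unfold_locales auto

text \<open>With \<open>Y = fps_X ^ m\<close> this replaces the polynomial variable \<open>x\<close>
  by \<open>q^m\<close>.\<close>

definition fps_poly :: "'a::comm_ring_1 poly \<Rightarrow> 'a fps \<Rightarrow> 'a fps" where
  "fps_poly p Y = poly (map_poly fps_const p) Y"

lemma fps_poly_mult: "fps_poly (p * q) Y = fps_poly p Y * fps_poly q Y"
proof -
  interpret h: comm_ring_hom "fps_const :: 'a \<Rightarrow> 'a fps" by (rule comm_ring_hom_fps_const)
  interpret m: map_poly_comm_ring_hom "fps_const :: 'a \<Rightarrow> 'a fps" ..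
  show ?thesis by (simp add: fps_poly_def m.hom_mult)
qed

lemma fps_poly_power: "fps_poly (p ^ T) Y = fps_poly p Y ^ T"
  by (induction T) (simp_all add: fps_poly_mult, simp add: fps_poly_def map_poly_1)

lemma fps_poly_1_minus: "fps_poly [:1, -1:] Y = 1 - (Y :: 'a::comm_ring_1 fps)"
proof -
  have "Y * fps_const (-1) = - Y" by (metis fps_const_1_eq_1 fps_const_neg mult_minus1_right)
  thus ?thesis by (simp add: fps_poly_def map_poly_pCons)
qed

lemma nth_X_power_mult_fps_poly:
  assumes "\<And>r. R < r \<Longrightarrow> coeff p r = 0 \<or> k + m * r \<noteq> i"
  shows "(fps_X ^ k * fps_poly p (fps_X ^ m)) $ i = (\<Sum>r\<le>R. if k + m * r = i then coeff p r else 0)"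
proof -
  have *: "(fps_X ^ k * (fps_const c * (fps_X ^ m) ^ r)) $ i = (if k + m * r = i then c else 0)" for c :: 'a and r
  proof -
    have eq: "fps_X ^ k * (fps_const c * (fps_X ^ m) ^ r) = fps_const c * fps_X ^ (k + m * r)"
      by (simp only: power_add power_mult mult_ac)
    show ?thesis unfolding eq by (simp add: fps_X_power_nth)
  qed
  have "fps_poly p (fps_X ^ m) = (\<Sum>r\<le>degree p. fps_const (coeff p r) * (fps_X ^ m) ^ r)"
    unfolding fps_poly_def poly_altdef by (simp add: coeff_map_poly degree_map_poly fps_const_eq_0_iff)
  hence "(fps_X ^ k * fps_poly p (fps_X ^ m)) $ i =
      (\<Sum>r\<le>degree p. if k + m * r = i then coeff p r else 0)"
    by (simp add: sum_distrib_left fps_sum_nth *)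
  also have "\<dots> = (\<Sum>r\<le>max R (degree p). if k + m * r = i then coeff p r else 0)"
    by (intro sum.mono_neutral_left) (auto simp: not_le coeff_eq_0)
  also have "\<dots> = (\<Sum>r\<le>R. if k + m * r = i then coeff p r else 0)"
  proof (intro sum.mono_neutral_right ballI)
    fix r assume "r \<in> {..max R (degree p)} - {..R}"
    thus "(if k + m * r = i then coeff p r else 0) = 0" using assms[of r] by auto
  qed auto
  finally show ?thesis .
qed

lemma fps_mult_nth_cong:
  assumes "\<And>i. i \<le> K \<Longrightarrow> f $ i = f' $ i" "\<And>i. i \<le> K \<Longrightarrow> g $ i = g' $ i" "i \<le> K"
  shows "(f * g) $ i = (f' * g') $ i"
  unfolding fps_mult_nth using assms by (intro sum.cong arg_cong2[where f = "(*)"]) auto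

lemma fps_power_nth_cong:
  assumes "\<And>i. i \<le> K \<Longrightarrow> f $ i = f' $ i" "i \<le> K"
  shows "(f ^ n) $ i = (f' ^ n) $ i"
  using assms(2)
  by (induction n arbitrary: i) (auto intro!: fps_mult_nth_cong[where K = K] assms(1))

context
  fixes F :: "nat \<Rightarrow> 'a::comm_ring_1 poly" and K T :: nat
  assumes degree_F: "\<And>k r. k < r \<Longrightarrow> coeff (F k) r = 0"
    and shift_F: "\<And>k r. k \<le> K \<Longrightarrow> coeff (F (k + r)) r = coeff ([:1, -1:] ^ T * F k) r"
begin

text \<open>With \<open>q = fps_X\<close>, the sum of all \<open>q^k F_k(q^m)\<close>, cut off at
  \<open>K\<close>. In the application \<open>F k\<close> is the trace polynomial in degree
  \<open>k\<close> above the lowest one.\<close>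

definition \<Phi> :: "nat \<Rightarrow> 'a fps" where
  "\<Phi> m = (\<Sum>k\<le>K. fps_X ^ k * fps_poly (F k) (fps_X ^ m))"

lemma \<Phi>_nth:
  assumes "i \<le> K"
  shows "\<Phi> m $ i = (\<Sum>k\<le>i. \<Sum>r\<le>k. if k + m * r = i then coeff (F k) r else 0)"
proof -
  have "\<Phi> m $ i = (\<Sum>k\<le>K. \<Sum>r\<le>k. if k + m * r = i then coeff (F k) r else 0)"
    unfolding \<Phi>_def fps_sum_nth
    by (intro sum.cong refl nth_X_power_mult_fps_poly) (use degree_F in blast)
  also have "\<dots> = (\<Sum>k\<le>i. \<Sum>r\<le>k. if k + m * r = i then coeff (F k) r else 0)"
    using assms by (intro sum.mono_neutral_right) (auto intro!: sum.neutral)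
  finally show ?thesis .
qed

text \<open>\<open>shift_F\<close> replaces coefficients of \<open>(1 - x)^T F_k\<close> by those of
  \<open>F_(k + r)\<close>, and \<open>k + Suc m * r = (k + r) + m * r\<close> matches them with the
  terms of \<open>\<Phi> m\<close>.\<close>

lemma \<Phi>_Suc:
  assumes i: "i \<le> K"
  shows "\<Phi> m $ i = ((1 - fps_X ^ Suc m) ^ T * \<Phi> (Suc m)) $ i"
proof -
  let ?H = "\<lambda>k. [:1, -1:] ^ T * F k"
  have "((1 - fps_X ^ Suc m) ^ T * \<Phi> (Suc m)) $ i =
      (\<Sum>k\<le>K. (fps_X ^ k * fps_poly (?H k) (fps_X ^ Suc m)) $ i)"
    by (simp add: \<Phi>_def sum_distrib_left fps_sum_nth fps_poly_mult fps_poly_power fps_poly_1_minus mult_ac)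
  also have "\<dots> = (\<Sum>k\<le>K. \<Sum>r\<le>i. if k + Suc m * r = i then coeff (?H k) r else 0)"
    by (intro sum.cong refl nth_X_power_mult_fps_poly) auto
  also have "\<dots> = (\<Sum>k\<le>K. \<Sum>r\<le>i. if k + Suc m * r = i then coeff (F (k + r)) r else 0)"
    by (intro sum.cong refl) (simp add: shift_F)
  also have "\<dots> = (\<Sum>k\<le>i. \<Sum>r\<le>i. if k + Suc m * r = i then coeff (F (k + r)) r else 0)"
    using i by (intro sum.mono_neutral_right) (auto intro!: sum.neutral)
  also have "\<dots> = (\<Sum>(k, r)\<in>{..i} \<times> {..i}. if k + Suc m * r = i then coeff (F (k + r)) r else 0)"
    by (simp add: sum.cartesian_product)
  also have "\<dots> = (\<Sum>(k, r)\<in>{(k, r). k + r \<le> i}. if k + Suc m * r = i then coeff (F (k + r)) r else 0)"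
    by (intro sum.mono_neutral_right) (auto split: if_splits)
  also have "\<dots> = (\<Sum>(k, r)\<in>(SIGMA k:{..i}. {..k}). if k + m * r = i then coeff (F k) r else 0)"
    by (rule sum.reindex_bij_witness[of _ "\<lambda>(k, r). (k - r, r)" "\<lambda>(k, r). (k + r, r)"]) auto
  also have "\<dots> = \<Phi> m $ i"
    by (simp add: \<Phi>_nth[OF i] sum.Sigma)
  finally show ?thesis ..
qed

text \<open>\<open>\<Phi>_Suc\<close> is iterated from \<open>m = 0\<close>, where the polynomials
  are evaluated at 1, to \<open>m = K + 1\<close>, where up to degree \<open>K\<close> only their
  constant coefficients remain.\<close>

lemma nth_eq_prod_nth:
  assumes i: "i \<le> K"
  shows "poly (F i) 1 = ((\<Prod>m\<le>K. 1 - fps_X ^ Suc m) ^ T * Abs_fps (\<lambda>k. coeff (F k) 0)) $ i"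
proof -
  have *: "\<Phi> 0 $ i = ((\<Prod>m<M. 1 - fps_X ^ Suc m) ^ T * \<Phi> M) $ i" if "i \<le> K" for i M
    using that
  proof (induction M arbitrary: i)
    case (Suc M)
    have "\<Phi> 0 $ i = ((\<Prod>m<M. 1 - fps_X ^ Suc m) ^ T * \<Phi> M) $ i" using Suc by blast
    also have "\<dots> = ((\<Prod>m<M. 1 - fps_X ^ Suc m) ^ T * ((1 - fps_X ^ Suc M) ^ T * \<Phi> (Suc M))) $ i"
      by (intro fps_mult_nth_cong[where K = K] \<Phi>_Suc Suc.prems) auto
    finally show ?case by (simp add: power_mult_distrib mult_ac)
  qed simp
  have "\<Phi> (Suc K) $ i = Abs_fps (\<lambda>k. coeff (F k) 0) $ i" if "i \<le> K" for i
  proof -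
    have "\<Phi> (Suc K) $ i = (\<Sum>k\<le>i. if k = i then coeff (F k) 0 else 0)"
      unfolding \<Phi>_nth[OF that]
    proof (intro sum.cong refl)
      fix k assume "k \<in> {..i}"
      have "k + Suc K * r \<noteq> i" if "r \<noteq> 0" for r
        using \<open>i \<le> K\<close> that by (cases r) auto
      hence "(\<Sum>r\<le>k. if k + Suc K * r = i then coeff (F k) r else 0) =
          (\<Sum>r\<le>k. if r = 0 then (if k = i then coeff (F k) 0 else 0) else 0)"
        by (intro sum.cong) auto
      thus "(\<Sum>r\<le>k. if k + Suc K * r = i then coeff (F k) r else 0) =
          (if k = i then coeff (F k) 0 else 0)" by simp
    qed
    thus ?thesis by simp
  qed
  hence "\<Phi> 0 $ i = ((\<Prod>m\<le>K. 1 - fps_X ^ Suc m) ^ T * Abs_fps (\<lambda>k. coeff (F k) 0)) $ i"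
    using *[OF i, of "Suc K"] fps_mult_nth_cong[OF refl _ i, of "\<Phi> (Suc K)"]
    by (simp add: lessThan_Suc_atMost)
  moreover have "\<Phi> 0 $ i = (\<Sum>k\<le>i. if k = i then (\<Sum>r\<le>k. coeff (F k) r) else 0)"
    unfolding \<Phi>_nth[OF i] by (intro sum.cong) auto
  moreover have "poly (F i) 1 = (\<Sum>r\<le>i. coeff (F i) r)"
  proof -
    have "degree (F i) \<le> i" using degree_F by (intro degree_le) auto
    thus ?thesis unfolding poly_altdef
      by (intro sum.mono_neutral_cong_left) (auto simp: coeff_eq_0)
  qed
  ultimately show ?thesis by simp
qed

end

text \<open>\<open>n = K + t\<close> makes the commutation rule valid up to \<open>K\<close> above
  the lowest degree. The trace polynomials give the left side at \<open>x = 1\<close> and the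
  numbers of basis vectors at \<open>x = 0\<close>.\<close>

lemma sum_minor_lower_before:
  assumes t: "0 < t" and k: "k \<le> K"
  defines "n \<equiv> K + t"
  shows "(\<Sum>xs\<in>incr_sum n ((\<Sum>i<n. i) + k). minor (lower_before (rising (of_nat t)) t) xs xs) =
    ((\<Prod>m\<le>K. 1 - fps_X ^ Suc m) ^ (t * t) *
     Abs_fps (\<lambda>k. of_nat (card (incr_sum n ((\<Sum>i<n. i) + k))))) $ k"
proof -
  let ?F = "\<lambda>k. trace_before n t ((\<Sum>i<n. i) + k) :: 'a::field_char_0 poly"
  have "poly (?F k) 1 = ((\<Prod>m\<le>K. 1 - fps_X ^ Suc m) ^ (t * t) * Abs_fps (\<lambda>k. coeff (?F k) 0)) $ k"
  proof (rule nth_eq_prod_nth[where F = ?F])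
    fix k r :: nat assume "k < r"
    thus "coeff (?F k) r = 0" by (intro coeff_trace_before_eq_0) simp
  next
    fix k r :: nat assume "k \<le> K"
    thus "coeff (?F (k + r)) r = coeff ([:1, -1:] ^ (t * t) * ?F k) r"
      using trace_after_eq[OF t, of K n "(\<Sum>i<n. i) + k", where 'a = 'a]
        coeff_trace_after[of n t "(\<Sum>i<n. i) + k" r, where 'a = 'a]
      by (simp add: n_def add.assoc)
  qed fact
  thus ?thesis by (simp add: poly_trace_before_1 coeff_trace_before_0)
qed

section \<open>The Cauchy determinant\<close>

lemma of_nat_mult_rising_Suc: "of_nat (Suc n) * rising s (Suc n) = s * rising (s + 1) n"
  by (simp add: rising_def pochhammer_rec field_simps del: of_nat_Suc)

lemma of_nat_mult_rising_Suc': "of_nat (Suc n) * rising s (Suc n) = (s + of_nat n) * rising s n"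
  by (simp add: rising_def pochhammer_Suc field_simps del: of_nat_Suc)

lemma mult_rising_add_1: "s * rising (s + 1) n = (s + of_nat n) * rising s n"
  using of_nat_mult_rising_Suc[of n s] of_nat_mult_rising_Suc'[of n s] by simp

text \<open>The matrix of \<open>(1 - S)^(-s) (1 - S*)^s\<close>. After multiplication of rows and columns by scalars
  it is the Cauchy matrix \<open>1 / (a - b + s)\<close>.\<close>
definition pairing :: "'a::field_char_0 \<Rightarrow> nat \<Rightarrow> nat \<Rightarrow> 'a" where
  "pairing s a b = (\<Sum>m\<le>min a b. rising s (a - m) * rising (- s) (b - m))"

lemma pairing_Suc:
  "pairing s (Suc a) (Suc b) = rising s (Suc a) * rising (- s) (Suc b) + pairing s a b"
  unfolding pairing_def min_Suc_Suc sum.atMost_Suc_shift by simp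

lemma lower_before_eq_pairing: "lower_before (rising (of_nat t)) t a b = pairing (of_nat t) a b"
proof -
  have "lower_before (rising (of_nat t)) t a b =
      (\<Sum>m<Suc a. toeplitz (rising (of_nat t)) a m * lowering t m b)"
    by (rule lower_before_eq_sum) simp
  also have "\<dots> = pairing (of_nat t) a b"
    unfolding pairing_def
    by (intro sum.mono_neutral_cong_right)
       (auto simp: toeplitz_def lowering_def rising_minus_of_nat)
  finally show ?thesis .
qed

text \<open>Induction along diagonals: \<open>pairing_Suc\<close> adds one product at each step, and
  the border cases are instances of \<open>mult_rising_add_1\<close>. Keeping the factor on the left
  covers its zeros too.\<close>

lemma pairing_closed_form:
  "(of_nat a - of_nat b + s) * pairing s a b = s * rising (s + 1) a * rising (1 - s) b"
proof (induction a arbitrary: b)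
  case 0
  show ?case using mult_rising_add_1[of "- s" b] by (simp add: pairing_def algebra_simps)
next
  case (Suc a)
  show ?case
  proof (cases b)
    case 0
    thus ?thesis using mult_rising_add_1[of s "Suc a"] by (simp add: pairing_def algebra_simps)
  next
    case (Suc c)
    define P where "P = rising (s + 1) a"
    define Q where "Q = rising (1 - s) c"
    have nz: "of_nat (Suc a) \<noteq> (0::'a)" "of_nat (Suc c) \<noteq> (0::'a)"
      by (rule of_nat_neq_0)+
    have 1: "rising s (Suc a) = s * P / of_nat (Suc a)"
      using of_nat_mult_rising_Suc[of a s] nz by (simp add: P_def field_simps del: of_nat_Suc)
    have 2: "rising (- s) (Suc c) = - s * Q / of_nat (Suc c)"
      using of_nat_mult_rising_Suc[of c "- s"] nz by (simp add: Q_def field_simps del: of_nat_Suc)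
    have 3: "rising (s + 1) (Suc a) = (s + 1 + of_nat a) * P / of_nat (Suc a)"
      using of_nat_mult_rising_Suc'[of a "s + 1"] nz by (simp add: P_def field_simps del: of_nat_Suc)
    have 4: "rising (1 - s) (Suc c) = (1 - s + of_nat c) * Q / of_nat (Suc c)"
      using of_nat_mult_rising_Suc'[of c "1 - s"] nz by (simp add: Q_def field_simps del: of_nat_Suc)
    have "(of_nat (Suc a) - of_nat (Suc c) + s) * pairing s (Suc a) (Suc c) =
        (of_nat a - of_nat c + s) * (rising s (Suc a) * rising (- s) (Suc c)) + s * P * Q"
      using Suc.IH[of c] by (simp add: pairing_Suc P_def Q_def algebra_simps)
    also have "\<dots> = s * rising (s + 1) (Suc a) * rising (1 - s) (Suc c)"
      unfolding 1 2 3 4 using nz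
      by (simp add: divide_simps del: of_nat_Suc) (simp add: algebra_simps)
    finally show ?thesis by (simp add: Suc)
  qed
qed

lemma rising_mult_rising: "rising (1 + s) a * rising (1 - s) a = (\<Prod>k=1..a. 1 - s\<^sup>2 / of_nat k ^ 2)"
proof (induction a)
  case (Suc a)
  have nz: "of_nat (Suc a) \<noteq> (0::'a)" by (rule of_nat_neq_0)
  have "rising (1 + s) (Suc a) = (of_nat (Suc a) + s) / of_nat (Suc a) * rising (1 + s) a"
    using of_nat_mult_rising_Suc'[of a "1 + s"] nz by (simp add: field_simps)
  moreover have "rising (1 - s) (Suc a) = (of_nat (Suc a) - s) / of_nat (Suc a) * rising (1 - s) a"
    using of_nat_mult_rising_Suc'[of a "1 - s"] nz by (simp add: field_simps)
  ultimately have "rising (1 + s) (Suc a) * rising (1 - s) (Suc a) =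
      (of_nat (Suc a) + s) * (of_nat (Suc a) - s) / of_nat (Suc a) ^ 2 *
      (rising (1 + s) a * rising (1 - s) a)"
    by (simp add: power2_eq_square del: of_nat_Suc)
  also have "(of_nat (Suc a) + s) * (of_nat (Suc a) - s) / of_nat (Suc a) ^ 2 =
      1 - s\<^sup>2 / of_nat (Suc a) ^ 2"
    using nz by (simp add: field_simps power2_eq_square del: of_nat_Suc)
  finally show ?case using Suc.IH by (simp add: prod.nat_ivl_Suc' del: of_nat_Suc)
qed simp

lemma det_scale_rows_cols:
  fixes r c :: "nat \<Rightarrow> 'a::comm_ring_1"
  shows "det (mat n n (\<lambda>(i, j). r i * c j * A i j)) =
    (\<Prod>i<n. r i) * (\<Prod>j<n. c j) * det (mat n n (\<lambda>(i, j). A i j))"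
proof -
  have "(\<Prod>i = 0..<n. c (p i)) = (\<Prod>j<n. c j)" if "p permutes {0..<n}" for p
    using prod.permute[OF that, of c] by (simp add: o_def atLeast0LessThan)
  thus ?thesis
    by (subst (1 2) det_def'[where n = n])
       (auto simp: sum_distrib_left prod.distrib atLeast0LessThan mult_ac intro!: sum.cong
         dest: permutes_in_image)
qed

text \<open>Column operations clear the last row except for the pivot and leave the Schur
  complement.\<close>

lemma det_pivot_last:
  fixes A :: "nat \<Rightarrow> nat \<Rightarrow> 'a::field"
  assumes "A n n \<noteq> 0"
  shows "det (mat (Suc n) (Suc n) (\<lambda>(i, j). A i j)) =
    A n n * det (mat n n (\<lambda>(i, j). A i j - A i n * A n j / A n n))"
proof -
  let ?M = "mat (Suc n) (Suc n) (\<lambda>(i, j). A i j)"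
  define V where "V = mat (Suc n) (Suc n)
    (\<lambda>(k, j). if k = j then 1 else if k = n then - A n j / A n n else 0)"
  define B where "B = mat (Suc n) (Suc n)
    (\<lambda>(i, j). if j = n then A i n else A i j - A i n * A n j / A n n)"
  have "B = ?M * V"
  proof (rule eq_matI)
    fix i j assume "i < dim_row (?M * V)" "j < dim_col (?M * V)"
    hence ij: "i < Suc n" "j < Suc n" by (auto simp: V_def)
    have "(?M * V) $$ (i, j) = (\<Sum>k = 0..<Suc n. A i k * V $$ (k, j))"
      using ij by (simp add: V_def scalar_prod_def)
    also have "\<dots> = (\<Sum>k = 0..<n. A i k * V $$ (k, j)) + A i n * V $$ (n, j)" by simp
    also have "(\<Sum>k = 0..<n. A i k * V $$ (k, j)) = (\<Sum>k = 0..<n. if k = j then A i k else 0)"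
      using ij by (intro sum.cong) (auto simp: V_def)
    also have "\<dots> + A i n * V $$ (n, j) = B $$ (i, j)"
      using ij by (auto simp: V_def B_def)
    finally show "B $$ (i, j) = (?M * V) $$ (i, j)" ..
  qed (auto simp: B_def V_def)
  hence "det B = det ?M * det V" by (simp add: det_mult[of _ "Suc n"] V_def)
  moreover have "det V = prod_list (diag_mat V)"
    by (rule det_lower_triangular[where n = "Suc n"]) (auto simp: V_def)
  hence "det V = 1" by (simp add: prod_list_diag_prod V_def)
  moreover have "det B = (\<Sum>j<Suc n. B $$ (n, j) * cofactor B n j)"
    by (rule laplace_expansion_row) (auto simp: B_def)
  hence "det B = A n n * cofactor B n n"
    using assms by (simp add: B_def)
  moreover have "cofactor B n n = det (mat n n (\<lambda>(i, j). A i j - A i n * A n j / A n n))"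
    unfolding cofactor_def by (simp, intro arg_cong[where f = det] eq_matI)
      (auto simp: mat_delete_def B_def)
  ultimately show ?thesis by simp
qed

text \<open>The Schur complement of the last entry is a smaller Cauchy matrix with rows scaled by
  \<open>r i\<close> and columns by \<open>c j\<close>.\<close>

lemma det_Cauchy:
  fixes x y :: "nat \<Rightarrow> 'a::field"
  assumes "\<And>i j. i < n \<Longrightarrow> j < n \<Longrightarrow> x i + y j \<noteq> 0"
  shows "det (mat n n (\<lambda>(i, j). 1 / (x i + y j))) =
    (\<Prod>i<n. \<Prod>j<i. (x i - x j) * (y i - y j)) / (\<Prod>i<n. \<Prod>j<n. x i + y j)"
  using assms
proof (induction n)
  case (Suc n)
  define r where "r i = (x i - x n) / (x i + y n)" for i
  define c where "c j = (y j - y n) / (x n + y j)" for j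
  have nz: "x i + y j \<noteq> 0" if "i \<le> n" "j \<le> n" for i j using Suc.prems that by simp
  have "det (mat (Suc n) (Suc n) (\<lambda>(i, j). 1 / (x i + y j))) = 1 / (x n + y n) *
      det (mat n n (\<lambda>(i, j). 1 / (x i + y j) - 1 / (x i + y n) * (1 / (x n + y j)) / (1 / (x n + y n))))"
    using nz by (subst det_pivot_last) auto
  also have "mat n n (\<lambda>(i, j). 1 / (x i + y j) - 1 / (x i + y n) * (1 / (x n + y j)) / (1 / (x n + y n))) =
      mat n n (\<lambda>(i, j). r i * c j * (1 / (x i + y j)))"
  proof (intro eq_matI, goal_cases)
    case (1 i j)
    hence "x i + y j \<noteq> 0" "x i + y n \<noteq> 0" "x n + y j \<noteq> 0" "x n + y n \<noteq> 0"
      using nz by auto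
    thus ?case using 1 by (simp add: r_def c_def divide_simps) (simp add: algebra_simps)
  qed auto
  also have "det \<dots> = (\<Prod>i<n. r i) * (\<Prod>j<n. c j) *
      ((\<Prod>i<n. \<Prod>j<i. (x i - x j) * (y i - y j)) / (\<Prod>i<n. \<Prod>j<n. x i + y j))"
    using Suc by (subst det_scale_rows_cols) simp
  also have "1 / (x n + y n) * \<dots> =
      (\<Prod>i<n. \<Prod>j<i. (x i - x j) * (y i - y j)) * ((\<Prod>i<n. x i - x n) * (\<Prod>j<n. y j - y n)) /
      ((\<Prod>i<n. \<Prod>j<n. x i + y j) * (\<Prod>i<n. x i + y n) * ((\<Prod>j<n. x n + y j) * (x n + y n)))"
    by (simp add: r_def c_def prod_dividef mult_ac)
  also have "(\<Prod>i<n. x i - x n) * (\<Prod>j<n. y j - y n) = (\<Prod>j<n. (x n - x j) * (y n - y j))"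
    unfolding prod.distrib[symmetric] by (intro prod.cong) (auto simp: algebra_simps)
  finally show ?case by (simp add: prod.distrib mult_ac)
qed simp

lemma prod_square_split:
  fixes g :: "nat \<Rightarrow> nat \<Rightarrow> 'a::comm_monoid_mult"
  shows "(\<Prod>i<n. \<Prod>j<n. g i j) = (\<Prod>i<n. g i i) * (\<Prod>i<n. \<Prod>j<i. g i j * g j i)"
  by (induction n) (simp_all add: prod.distrib mult_ac)

text \<open>A nonintegral \<open>s\<close> keeps all Cauchy denominators nonzero. Grouping the
  positions \<open>(i, j)\<close> and \<open>(j, i)\<close> produces the reciprocals of the factors
  on the left.\<close>

lemma minor_pairing:
  fixes s :: "'a::field_char_0"
  assumes s: "s \<notin> \<int>" and incr: "sorted_wrt (<) xs"
  shows "minor (pairing s) xs xs *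
      (\<Prod>i<length xs. \<Prod>j<i. 1 - s\<^sup>2 / (of_nat (xs ! i) - of_nat (xs ! j)) ^ 2) =
    (\<Prod>i<length xs. \<Prod>k=1..xs ! i. 1 - s\<^sup>2 / of_nat k ^ 2)"
proof -
  let ?n = "length xs"
  define x :: "nat \<Rightarrow> 'a" where "x i = of_nat (xs ! i)" for i
  have nz: "x i + s - x j \<noteq> 0" for i j
  proof
    assume "x i + s - x j = 0"
    hence "s = of_int (int (xs ! j) - int (xs ! i))" by (simp add: x_def algebra_simps)
    thus False using s by (metis Ints_of_int)
  qed
  have s0: "s \<noteq> 0" using s by auto
  have neq: "x i - x j \<noteq> 0" if "j < i" "i < ?n" for i j
    using incr that by (fastforce simp: x_def sorted_wrt_iff_nth_less)
  have "minor (pairing s) xs xs = det (mat ?n ?n (\<lambda>(i, j). (s * rising (1 + s) (xs ! i)) *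
      rising (1 - s) (xs ! j) * (1 / ((x i + s) + - x j))))"
    unfolding minor_def
  proof (intro arg_cong[where f = det] eq_matI, goal_cases)
    case (1 i j)
    thus ?case using pairing_closed_form[of "xs ! i" "xs ! j" s] nz[of i j]
      by (simp add: x_def field_simps)
  qed auto
  also have "\<dots> = (\<Prod>i<?n. s * rising (1 + s) (xs ! i)) * (\<Prod>i<?n. rising (1 - s) (xs ! i)) *
      ((\<Prod>i<?n. \<Prod>j<i. (x i - x j) * (x j - x i)) / (\<Prod>i<?n. \<Prod>j<?n. x i + s - x j))"
    by (subst det_scale_rows_cols, subst det_Cauchy) (use nz in simp_all)
  also have "(\<Prod>i<?n. \<Prod>j<?n. x i + s - x j) =
      (\<Prod>i<?n. s) * (\<Prod>i<?n. \<Prod>j<i. (x i + s - x j) * (x j + s - x i))"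
    by (subst prod_square_split) simp
  also have "(\<Prod>i<?n. s * rising (1 + s) (xs ! i)) * (\<Prod>i<?n. rising (1 - s) (xs ! i)) *
      ((\<Prod>i<?n. \<Prod>j<i. (x i - x j) * (x j - x i)) /
       ((\<Prod>i<?n. s) * (\<Prod>i<?n. \<Prod>j<i. (x i + s - x j) * (x j + s - x i)))) =
      (\<Prod>i<?n. rising (1 + s) (xs ! i) * rising (1 - s) (xs ! i)) *
      (\<Prod>i<?n. \<Prod>j<i. (x i - x j) * (x j - x i) / ((x i + s - x j) * (x j + s - x i)))"
    using s0 by (simp add: prod.distrib prod_dividef)
  finally have "minor (pairing s) xs xs = (\<Prod>i<?n. \<Prod>k=1..xs ! i. 1 - s\<^sup>2 / of_nat k ^ 2) *
      (\<Prod>i<?n. \<Prod>j<i. (x i - x j) * (x j - x i) / ((x i + s - x j) * (x j + s - x i)))"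
    by (simp add: rising_mult_rising)
  moreover have "(\<Prod>i<?n. \<Prod>j<i. (x i - x j) * (x j - x i) / ((x i + s - x j) * (x j + s - x i))) *
      (\<Prod>i<?n. \<Prod>j<i. 1 - s\<^sup>2 / (x i - x j) ^ 2) = 1"
    unfolding prod.distrib[symmetric]
  proof (intro prod.neutral ballI)
    fix i j assume ij: "i \<in> {..<?n}" "j \<in> {..<i}"
    have "x i - x j \<noteq> 0" using neq ij by simp
    hence "1 - s\<^sup>2 / (x i - x j) ^ 2 =
        ((x i + s - x j) * (x j + s - x i)) / ((x i - x j) * (x j - x i))"
      by (simp add: divide_simps) (simp add: power2_eq_square algebra_simps)
    thus "(x i - x j) * (x j - x i) / ((x i + s - x j) * (x j + s - x i)) *
        (1 - s\<^sup>2 / (x i - x j) ^ 2) = 1"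
      using nz[of i j] nz[of j i] \<open>x i - x j \<noteq> 0\<close> by simp
  qed
  ultimately show ?thesis by (simp add: x_def mult.assoc)
qed

section \<open>Hook lengths\<close>

text \<open>The first-column hook lengths of the partition padded by zeros to \<open>n\<close> parts, in increasing order.\<close>
definition beta_list :: "nat \<Rightarrow> nat list \<Rightarrow> nat list" where
  "beta_list n \<mu> = map (\<lambda>i. part \<mu> (n - i) + i) [0..<n]"

lemma beta_list_length [simp]: "length (beta_list n \<mu>) = n"
  by (simp add: beta_list_def)

lemma beta_list_nth [simp]: "i < n \<Longrightarrow> beta_list n \<mu> ! i = part \<mu> (n - i) + i"
  by (simp add: beta_list_def)

lemma part_antimono:
  assumes "sorted_wrt (\<ge>) \<mu>" "1 \<le> i" "i \<le> j"
  shows "part \<mu> j \<le> part \<mu> i"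
proof (cases "i < j")
  case True
  thus ?thesis using assms by (auto simp: part_def sorted_wrt_iff_nth_less)
next
  case False
  thus ?thesis using assms by simp
qed

lemma part_pos_iff: "0 \<notin> set \<mu> \<Longrightarrow> 0 < part \<mu> i \<longleftrightarrow> 1 \<le> i \<and> i \<le> length \<mu>"
  by (auto simp: part_def in_set_conv_nth Suc_le_eq)

lemma sum_part: "length \<mu> \<le> n \<Longrightarrow> (\<Sum>i=1..n. part \<mu> i) = sum_list \<mu>"
proof -
  assume len: "length \<mu> \<le> n"
  have "(\<Sum>i=1..n. part \<mu> i) = (\<Sum>i=1..length \<mu>. part \<mu> i)"
    using len by (intro sum.mono_neutral_right) (auto simp: part_def)
  also have "\<dots> = (\<Sum>i<length \<mu>. \<mu> ! i)"
    by (rule sum.reindex_bij_witness[of _ Suc "\<lambda>i. i - 1"]) (auto simp: part_def)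
  finally show ?thesis by (simp add: sum_list_sum_nth atLeast0LessThan)
qed

lemma length_le_sum_list: "0 \<notin> set \<mu> \<Longrightarrow> length (\<mu> :: nat list) \<le> sum_list \<mu>"
  by (induction \<mu>) auto

lemma beta_list_in_incr_sum:
  assumes \<mu>: "\<mu> \<in> partitions k" and k: "k \<le> n"
  shows "beta_list n \<mu> \<in> incr_sum n ((\<Sum>i<n. i) + k)"
proof -
  have s: "sorted_wrt (\<ge>) \<mu>" "sum_list \<mu> = k" "length \<mu> \<le> n"
    using \<mu> k length_le_sum_list[of \<mu>] by (auto simp: partitions_def)
  have "sorted_wrt (<) (beta_list n \<mu>)"
    unfolding sorted_wrt_iff_nth_less
    using part_antimono[OF s(1)] by (auto intro!: add_le_less_mono)
  moreover have "sum_list (beta_list n \<mu>) = (\<Sum>i<n. i) + k"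
  proof -
    have "sum_list (beta_list n \<mu>) = (\<Sum>i<n. part \<mu> (n - i)) + (\<Sum>i<n. i)"
      by (simp add: sum_list_sum_nth atLeast0LessThan sum.distrib)
    also have "(\<Sum>i<n. part \<mu> (n - i)) = (\<Sum>i=1..n. part \<mu> i)"
      by (rule sum.reindex_bij_witness[of _ "\<lambda>i. n - i" "\<lambda>i. n - i"]) auto
    finally show ?thesis using sum_part[OF s(3)] s(2) by simp
  qed
  ultimately show ?thesis by (simp add: incr_sum_def)
qed

lemma inj_on_beta_list: "k \<le> n \<Longrightarrow> inj_on (beta_list n) (partitions k)"
proof (rule inj_onI)
  fix \<mu> \<nu> assume k: "k \<le> n" and \<mu>: "\<mu> \<in> partitions k" and \<nu>: "\<nu> \<in> partitions k"
    and eq: "beta_list n \<mu> = beta_list n \<nu>"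
  have nz: "0 \<notin> set \<mu>" "0 \<notin> set \<nu>" and len: "length \<mu> \<le> n" "length \<nu> \<le> n"
    using \<mu> \<nu> k length_le_sum_list[of \<mu>] length_le_sum_list[of \<nu>] by (auto simp: partitions_def)
  have part: "part \<mu> i = part \<nu> i" for i
  proof (cases "1 \<le> i \<and> i \<le> n")
    case True
    thus ?thesis using arg_cong[OF eq, of "\<lambda>xs. xs ! (n - i)"] by simp arith
  next
    case False
    thus ?thesis using len by (auto simp: part_def)
  qed
  have "i \<le> length \<mu> \<longleftrightarrow> i \<le> length \<nu>" for i
    using part_pos_iff[OF nz(1), of i] part_pos_iff[OF nz(2), of i] part[of i] by (cases "i = 0") auto
  hence "length \<mu> = length \<nu>" using le_antisym by blast
  moreover have "\<mu> ! i = \<nu> ! i" if "i < length \<mu>" for i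
    using part[of "Suc i"] that calculation by (simp add: part_def)
  ultimately show "\<mu> = \<nu>" by (rule nth_equalityI)
qed

text \<open>Subtracting the staircase \<open>0, ..., n - 1\<close> from \<open>xs\<close> leaves a
  weakly increasing list; reversed and cut before its zeros, it is the required partition.\<close>

lemma incr_sum_subset_beta_list:
  assumes "xs \<in> incr_sum n ((\<Sum>i<n. i) + k)"
  shows "xs \<in> beta_list n ` partitions k"
proof -
  have len: "length xs = n" and incr: "sorted_wrt (<) xs" and sum: "sum_list xs = (\<Sum>i<n. i) + k"
    using assms by (auto simp: incr_sum_def)
  define y where "y i = xs ! i - i" for i
  have y: "xs ! i = y i + i" if "i < n" for i
    using incr_nth_ge[OF incr, of i] that len by (simp add: y_def)
  have y_Suc: "y i \<le> y (Suc i)" if "Suc i < n" for i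
  proof -
    have "xs ! i < xs ! Suc i" using incr that len by (auto simp: sorted_wrt_iff_nth_less)
    thus ?thesis using y[of i] y[of "Suc i"] that by simp
  qed
  have y_mono: "y i \<le> y j" if "i \<le> j" "j < n" for i j
    using that by (induction j rule: dec_induct) (auto intro: order_trans[OF _ y_Suc])
  define L where "L = map (\<lambda>i. y (n - 1 - i)) [0..<n]"
  define \<mu> where "\<mu> = takeWhile (\<lambda>v. v \<noteq> 0) L"
  have sorted_L: "sorted_wrt (\<ge>) L"
    unfolding sorted_wrt_iff_nth_less L_def by (auto intro!: y_mono)
  have \<mu>_take: "\<mu> = take (length \<mu>) L" unfolding \<mu>_def by (rule takeWhile_eq_take)
  have L_0: "L ! i = 0" if "length \<mu> \<le> i" "i < n" for i
  proof -
    have "length \<mu> < length L" using that by (simp add: L_def)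
    hence "L ! length \<mu> = 0" using nth_length_takeWhile[of "\<lambda>v. v \<noteq> 0" L] by (simp add: \<mu>_def)
    moreover have "L ! i \<le> L ! length \<mu>"
      using that sorted_L by (cases "i = length \<mu>") (auto simp: sorted_wrt_iff_nth_less L_def)
    ultimately show ?thesis by simp
  qed
  have len_\<mu>: "length \<mu> \<le> n" using length_takeWhile_le[of "\<lambda>v. v \<noteq> 0" L] by (simp add: \<mu>_def L_def)
  have part: "part \<mu> (n - i) = y i" if "i < n" for i
  proof (cases "n - i \<le> length \<mu>")
    case True
    hence "part \<mu> (n - i) = L ! (n - i - 1)"
      using that takeWhile_nth[of "n - i - 1" "\<lambda>v. v \<noteq> 0" L] by (simp add: part_def \<mu>_def)
    thus ?thesis using that by (simp add: L_def)
  next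
    case False
    hence "L ! (n - i - 1) = 0" using that by (intro L_0) auto
    moreover have "L ! (n - i - 1) = y i" using that by (simp add: L_def)
    ultimately show ?thesis using False by (simp add: part_def)
  qed
  have beta: "beta_list n \<mu> = xs"
    by (rule nth_equalityI) (use len part y in auto)
  have "sorted_wrt (\<ge>) \<mu>" by (subst \<mu>_take) (rule sorted_wrt_take[OF sorted_L])
  moreover have "0 \<notin> set \<mu>" by (auto simp: \<mu>_def dest: set_takeWhileD)
  moreover have "sum_list \<mu> = k"
  proof -
    have "sum_list \<mu> = (\<Sum>i=1..n. part \<mu> i)" using sum_part[OF len_\<mu>] by simp
    also have "\<dots> = (\<Sum>i<n. part \<mu> (n - i))"
      by (rule sum.reindex_bij_witness[of _ "\<lambda>i. n - i" "\<lambda>i. n - i"]) auto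
    also have "\<dots> = (\<Sum>i<n. y i)" using part by simp
    also have "\<dots> + (\<Sum>i<n. i) = sum_list xs"
      using y len by (simp add: sum_list_sum_nth atLeast0LessThan flip: sum.distrib)
    finally show ?thesis using sum by simp
  qed
  ultimately show ?thesis using beta by (auto simp: partitions_def)
qed

lemma bij_betw_beta_list:
  "k \<le> n \<Longrightarrow> bij_betw (beta_list n) (partitions k) (incr_sum n ((\<Sum>i<n. i) + k))"
  using inj_on_beta_list[of k n] beta_list_in_incr_sum[of _ k n] incr_sum_subset_beta_list[of _ n k]
  by (auto simp: bij_betw_def)

section \<open>Boxes, conjugate parts and the hook lengths of a row\<close>

lemma finite_boxes: "finite (boxes \<mu>)"
proof (rule finite_subset)
  show "boxes \<mu> \<subseteq> (SIGMA i:{1..length \<mu>}. {1..part \<mu> i})" by (auto simp: boxes_def)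
qed auto

lemma conj_part_le: "conj_part \<mu> j \<le> length \<mu>"
proof -
  have "{k. 1 \<le> k \<and> k \<le> length \<mu> \<and> part \<mu> k \<ge> j} \<subseteq> {1..length \<mu>}" by auto
  from card_mono[OF _ this] show ?thesis by (simp add: conj_part_def)
qed

text \<open>By monotonicity the rows counted by \<open>conj_part\<close> form an initial
  segment.\<close>

lemma le_part_iff_le_conj_part:
  assumes "sorted_wrt (\<ge>) \<mu>" "1 \<le> i" "1 \<le> j"
  shows "j \<le> part \<mu> i \<longleftrightarrow> i \<le> conj_part \<mu> j"
proof -
  let ?S = "{k. 1 \<le> k \<and> k \<le> length \<mu> \<and> part \<mu> k \<ge> j}"
  have fin: "finite ?S" by simp
  show ?thesis
  proof
    assume le: "j \<le> part \<mu> i"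
    hence "i \<le> length \<mu>" using assms(3) by (auto simp: part_def split: if_splits)
    hence "{1..i} \<subseteq> ?S" using le part_antimono[OF assms(1)] by (force intro: order_trans)
    from card_mono[OF fin this] show "i \<le> conj_part \<mu> j" by (simp add: conj_part_def)
  next
    assume le: "i \<le> conj_part \<mu> j"
    show "j \<le> part \<mu> i"
    proof (rule ccontr)
      assume "\<not> j \<le> part \<mu> i"
      hence "?S \<subseteq> {1..<i}" using part_antimono[OF assms(1), of i] assms(2)
        by (force simp: not_le)
      from card_mono[OF _ this] le assms(2) show False by (simp add: conj_part_def)
    qed
  qed
qed

text \<open>Index \<open>i\<close> belongs to row \<open>n - i\<close>. Both sets lie in
  \<open>{1..b i}\<close>, they are disjoint, and their sizes \<open>part \<mu> (n - i)\<close> and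
  \<open>i\<close> add up to \<open>b i\<close>, so they fill the interval.\<close>

lemma row_hook_lengths:
  assumes \<mu>: "sorted_wrt (\<ge>) \<mu>" "length \<mu> \<le> n" and i: "i < n"
  defines "b \<equiv> \<lambda>i. int (beta_list n \<mu> ! i)"
  defines "H \<equiv> (\<lambda>j. hook_length \<mu> (n - i, j)) ` {1..part \<mu> (n - i)}" and "D \<equiv> (\<lambda>j. b i - b j) ` {..<i}"
  shows "H \<inter> D = {}" "H \<union> D = {1..b i}"
    "inj_on (\<lambda>j. hook_length \<mu> (n - i, j)) {1..part \<mu> (n - i)}" "inj_on (\<lambda>j. b i - b j) {..<i}"
proof -
  define r where "r = n - i"
  have r: "1 \<le> r" "r \<le> n" "i = n - r" using i by (auto simp: r_def)
  have hook: "hook_length \<mu> (n - i, j) = int (part \<mu> r) - int j + int (conj_part \<mu> j) - int r + 1" for j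
    by (simp add: hook_length_def r_def)
  have b: "b j = int (part \<mu> (n - j)) + int j" if "j < n" for j using that by (simp add: b_def)
  have conj: "r \<le> conj_part \<mu> j" "conj_part \<mu> j \<le> n" if "j \<in> {1..part \<mu> r}" for j
    using le_part_iff_le_conj_part[OF \<mu>(1) r(1), of j] conj_part_le[of \<mu> j] \<mu>(2) that by auto
  have conj_anti: "conj_part \<mu> j' \<le> conj_part \<mu> j" if "j \<le> j'" for j j'
    unfolding conj_part_def using that by (intro card_mono) auto
  show inj1: "inj_on (\<lambda>j. hook_length \<mu> (n - i, j)) {1..part \<mu> (n - i)}"
  proof (rule inj_onI)
    fix j j' assume eq: "hook_length \<mu> (n - i, j) = hook_length \<mu> (n - i, j')"
    show "j = j'"
      using eq conj_anti[of j j'] conj_anti[of j' j] unfolding hook by (cases j j' rule: linorder_cases) auto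
  qed
  have b_mono: "b j < b j'" if "j < j'" "j' < n" for j j'
  proof -
    have "part \<mu> (n - j) \<le> part \<mu> (n - j')" by (rule part_antimono[OF \<mu>(1)]) (use that in auto)
    thus ?thesis using that by (simp add: b)
  qed
  show inj2: "inj_on (\<lambda>j. b i - b j) {..<i}"
  proof (rule inj_onI)
    fix j j' assume "j \<in> {..<i}" "j' \<in> {..<i}" "b i - b j = b i - b j'"
    thus "j = j'" using b_mono[of j j'] b_mono[of j' j] i by (cases j j' rule: linorder_cases) auto
  qed
  show disj: "H \<inter> D = {}"
  proof (rule ccontr)
    assume "H \<inter> D \<noteq> {}"
    then obtain h where "h \<in> H" "h \<in> D" by blast
    from \<open>h \<in> H\<close> obtain j where j: "j \<in> {1..part \<mu> r}" and hj: "h = hook_length \<mu> (n - i, j)"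
      unfolding H_def r_def by (elim imageE)
    from \<open>h \<in> D\<close> obtain l where "l \<in> {..<i}" and hl: "h = b i - b l"
      unfolding D_def by (elim imageE)
    hence l: "l < i" and eq: "hook_length \<mu> (n - i, j) = b i - b l" using hj by auto
    define q where "q = n - l"
    have q: "l = n - q" "1 \<le> q" "q \<le> n" using l i by (auto simp: q_def)
    \<comment> \<open>This equation expresses a coincidence of a hook length with a difference. Its
      left side is too large if \<open>(q, j)\<close> is a box and too small otherwise.\<close>
    have "int (part \<mu> q) + int (conj_part \<mu> j) + 1 = int q + int j"
      using eq l i r q unfolding hook by (simp add: b r_def[symmetric] q_def[symmetric] of_nat_diff)
    moreover have "j \<le> part \<mu> q \<longleftrightarrow> q \<le> conj_part \<mu> j"
      using le_part_iff_le_conj_part[OF \<mu>(1) q(2), of j] j by simp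
    ultimately show False by linarith
  qed
  have sub: "H \<union> D \<subseteq> {1..b i}"
  proof -
    have "hook_length \<mu> (n - i, j) \<in> {1..b i}" if "j \<in> {1..part \<mu> r}" for j
      using conj[OF that] that r i unfolding hook by (auto simp: b r_def[symmetric] of_nat_diff)
    moreover have "b i - b j \<in> {1..b i}" if "j < i" for j
      using b_mono[OF that i] by (simp add: b_def)
    ultimately show ?thesis by (auto simp: H_def D_def r_def)
  qed
  have "card (H \<union> D) = part \<mu> r + i"
    using disj card_image[OF inj1] card_image[OF inj2]
    by (subst card_Un_disjoint) (auto simp: H_def D_def r_def)
  also have "\<dots> = card {1..b i}" using i by (simp add: b r_def)
  finally show "H \<union> D = {1..b i}" using sub by (intro card_subset_eq) auto
qed

text \<open>The row statement is multiplied over all rows. The form without quotients admits every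
  \<open>f\<close>, even with zero values.\<close>

lemma prod_boxes_hook_length:
  fixes f :: "int \<Rightarrow> 'a::comm_monoid_mult"
  assumes \<mu>: "sorted_wrt (\<ge>) \<mu>" "length \<mu> \<le> n"
  shows "(\<Prod>v\<in>boxes \<mu>. f (hook_length \<mu> v)) *
      (\<Prod>i<n. \<Prod>j<i. f (int (beta_list n \<mu> ! i) - int (beta_list n \<mu> ! j))) =
    (\<Prod>i<n. \<Prod>k=1..beta_list n \<mu> ! i. f (int k))"
proof -
  have "boxes \<mu> = (SIGMA r:{1..n}. {1..part \<mu> r})"
    using \<mu>(2) by (auto simp: boxes_def part_def split: if_splits)
  hence "(\<Prod>v\<in>boxes \<mu>. f (hook_length \<mu> v)) =
      (\<Prod>r=1..n. \<Prod>j=1..part \<mu> r. f (hook_length \<mu> (r, j)))"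
    by (simp add: prod.Sigma split_def)
  also have "\<dots> = (\<Prod>i<n. \<Prod>j=1..part \<mu> (n - i). f (hook_length \<mu> (n - i, j)))"
    by (rule prod.reindex_bij_witness[of _ "\<lambda>i. n - i" "\<lambda>i. n - i"]) auto
  finally have boxes: "(\<Prod>v\<in>boxes \<mu>. f (hook_length \<mu> v)) =
    (\<Prod>i<n. \<Prod>j=1..part \<mu> (n - i). f (hook_length \<mu> (n - i, j)))" .
  show ?thesis
    unfolding boxes prod.distrib[symmetric]
  proof (intro prod.cong refl)
    fix i assume "i \<in> {..<n}"
    hence i: "i < n" by simp
    note row = row_hook_lengths[OF \<mu> i]
    let ?b = "\<lambda>i. int (beta_list n \<mu> ! i)"
    have "(\<Prod>j=1..part \<mu> (n - i). f (hook_length \<mu> (n - i, j))) * (\<Prod>j<i. f (?b i - ?b j)) =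
        (\<Prod>k\<in>(\<lambda>j. hook_length \<mu> (n - i, j)) ` {1..part \<mu> (n - i)}. f k) *
        (\<Prod>k\<in>(\<lambda>j. ?b i - ?b j) ` {..<i}. f k)"
      using prod.reindex[OF row(3), of f] prod.reindex[OF row(4), of f] by (simp add: o_def)
    also have "\<dots> = (\<Prod>k\<in>{1..?b i}. f k)"
      by (subst prod.union_disjoint[symmetric]) (simp_all only: row(1,2) finite_imageI finite_lessThan finite_atLeastAtMost)
    also have "\<dots> = (\<Prod>k=1..beta_list n \<mu> ! i. f (int k))"
      by (rule prod.reindex_bij_witness[of _ int nat]) auto
    finally show "(\<Prod>j=1..part \<mu> (n - i). f (hook_length \<mu> (n - i, j))) * (\<Prod>j<i. f (?b i - ?b j)) =
      (\<Prod>k=1..beta_list n \<mu> ! i. f (int k))" .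
  qed
qed

definition hook_prod :: "'a::field_char_0 \<Rightarrow> nat list \<Rightarrow> 'a" where
  "hook_prod z \<mu> = (\<Prod>v\<in>boxes \<mu>. 1 - z / of_int (hook_length \<mu> v) ^ 2)"

text \<open>By \<open>minor_pairing\<close> and \<open>prod_boxes_hook_length\<close> both sides
  become equal after multiplication by \<open>?d\<close>, which is nonzero for nonintegral
  \<open>s\<close>.\<close>

lemma minor_pairing_eq_hook_prod_nonint:
  fixes s :: "'a::field_char_0"
  assumes s: "s \<notin> \<int>" and \<mu>: "\<mu> \<in> partitions k" and k: "k \<le> n"
  shows "minor (pairing s) (beta_list n \<mu>) (beta_list n \<mu>) = hook_prod (s\<^sup>2) \<mu>"
proof -
  let ?b = "beta_list n \<mu>"
  have m: "sorted_wrt (\<ge>) \<mu>" "length \<mu> \<le> n"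
    using \<mu> k length_le_sum_list[of \<mu>] by (auto simp: partitions_def)
  have incr: "sorted_wrt (<) ?b"
    using beta_list_in_incr_sum[OF \<mu> k] by (simp add: incr_sum_def)
  let ?d = "(\<Prod>i<n. \<Prod>j<i. 1 - s\<^sup>2 / (of_nat (?b ! i) - of_nat (?b ! j)) ^ 2)"
  have "minor (pairing s) ?b ?b * ?d = (\<Prod>i<n. \<Prod>k=1..?b ! i. 1 - s\<^sup>2 / of_nat k ^ 2)"
    using minor_pairing[OF s incr] by simp
  also have "\<dots> = hook_prod (s\<^sup>2) \<mu> * ?d"
    using prod_boxes_hook_length[OF m, of "\<lambda>h. 1 - s\<^sup>2 / of_int h ^ 2"] by (simp add: hook_prod_def)
  finally have "minor (pairing s) ?b ?b * ?d = hook_prod (s\<^sup>2) \<mu> * ?d" .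
  moreover have "?d \<noteq> 0"
  proof -
    have "1 - s\<^sup>2 / (of_nat (?b ! i) - of_nat (?b ! j)) ^ 2 \<noteq> 0" for i j
    proof
      assume *: "1 - s\<^sup>2 / (of_nat (?b ! i) - of_nat (?b ! j)) ^ 2 = 0"
      let ?c = "int (?b ! i) - int (?b ! j)"
      have "s\<^sup>2 = of_int ?c ^ 2"
        \<comment> \<open>If \<open>?c = 0\<close>, division by zero gives 0 and the assumption
          reads \<open>1 = 0\<close>.\<close>
        using * by (cases "?c = 0") (auto simp: divide_simps split: if_splits)
      hence "s = of_int ?c \<or> s = of_int (- ?c)" by (simp add: power2_eq_iff)
      thus False using s by (metis Ints_of_int)
    qed
    thus ?thesis by (simp only: prod_zero_iff finite_lessThan) blast
  qed
  ultimately show ?thesis using mult_right_cancel by blast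
qed

section \<open>Polynomial functions determined by infinitely many values\<close>

definition polynomial_fun :: "('a::field_char_0 \<Rightarrow> 'a) \<Rightarrow> bool" where
  "polynomial_fun f \<longleftrightarrow> (\<exists>p. \<forall>x. f x = poly p x)"

named_theorems polynomial_fun_intros

lemma polynomial_fun_const [polynomial_fun_intros]: "polynomial_fun (\<lambda>x. c)"
  unfolding polynomial_fun_def by (rule exI[of _ "[:c:]"]) simp

lemma polynomial_fun_ident [polynomial_fun_intros]: "polynomial_fun (\<lambda>x. x)"
  unfolding polynomial_fun_def by (rule exI[of _ "[:0, 1:]"]) simp

lemma polynomial_fun_uminus [polynomial_fun_intros]:
  "polynomial_fun f \<Longrightarrow> polynomial_fun (\<lambda>x. - f x)"
  unfolding polynomial_fun_def by (metis poly_minus)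

lemma polynomial_fun_add [polynomial_fun_intros]:
  "polynomial_fun f \<Longrightarrow> polynomial_fun g \<Longrightarrow> polynomial_fun (\<lambda>x. f x + g x)"
  unfolding polynomial_fun_def by (metis poly_add)

lemma polynomial_fun_diff [polynomial_fun_intros]:
  "polynomial_fun f \<Longrightarrow> polynomial_fun g \<Longrightarrow> polynomial_fun (\<lambda>x. f x - g x)"
  unfolding polynomial_fun_def by (metis poly_diff)

lemma polynomial_fun_mult [polynomial_fun_intros]:
  "polynomial_fun f \<Longrightarrow> polynomial_fun g \<Longrightarrow> polynomial_fun (\<lambda>x. f x * g x)"
  unfolding polynomial_fun_def by (metis poly_mult)

lemma polynomial_fun_divide [polynomial_fun_intros]:
  "polynomial_fun f \<Longrightarrow> polynomial_fun (\<lambda>x. f x / c)"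
  using polynomial_fun_mult[OF _ polynomial_fun_const, of f "inverse c"] by (simp add: field_simps)

lemma polynomial_fun_power [polynomial_fun_intros]:
  "polynomial_fun f \<Longrightarrow> polynomial_fun (\<lambda>x. f x ^ n)"
  by (induction n) (auto intro!: polynomial_fun_intros)

lemma polynomial_fun_sum [polynomial_fun_intros]:
  "(\<And>i. i \<in> I \<Longrightarrow> polynomial_fun (f i)) \<Longrightarrow> polynomial_fun (\<lambda>x. \<Sum>i\<in>I. f i x)"
  by (induction I rule: infinite_finite_induct) (auto intro!: polynomial_fun_intros)

lemma polynomial_fun_prod [polynomial_fun_intros]:
  "(\<And>i. i \<in> I \<Longrightarrow> polynomial_fun (f i)) \<Longrightarrow> polynomial_fun (\<lambda>x. \<Prod>i\<in>I. f i x)"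
  by (induction I rule: infinite_finite_induct) (auto intro!: polynomial_fun_intros)

lemma polynomial_fun_eqI:
  assumes f: "polynomial_fun f" and g: "polynomial_fun g"
    and inj: "inj u" and eq: "\<And>n :: nat. f (u n) = g (u n)"
  shows "f x = g x"
proof -
  obtain p q where p: "\<And>x. f x = poly p x" and q: "\<And>x. g x = poly q x"
    using f g unfolding polynomial_fun_def by blast
  have "range u \<subseteq> {x. poly (p - q) x = 0}" using eq p q by auto
  hence "infinite {x. poly (p - q) x = 0}" using range_inj_infinite[OF inj] finite_subset by blast
  hence "p - q = 0" using poly_roots_finite by blast
  thus ?thesis using p q by simp
qed

lemma polynomial_fun_rising [polynomial_fun_intros]:
  "polynomial_fun f \<Longrightarrow> polynomial_fun (\<lambda>s. rising (f s) n)"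
  unfolding rising_def pochhammer_prod by (intro polynomial_fun_intros)

lemma polynomial_fun_minor_pairing: "polynomial_fun (\<lambda>s. minor (pairing s) xs ys)"
  unfolding minor_leibniz pairing_def by (intro polynomial_fun_intros)

lemma polynomial_fun_hook_prod [polynomial_fun_intros]:
  "polynomial_fun f \<Longrightarrow> polynomial_fun (\<lambda>z. hook_prod (f z) \<mu>)"
  unfolding hook_prod_def by (intro polynomial_fun_intros)

lemma half_plus_nat_not_int: "of_nat m + 1 / 2 \<notin> (\<int> :: 'a::field_char_0 set)"
proof
  assume "of_nat m + 1 / 2 \<in> (\<int> :: 'a set)"
  then obtain i where "of_nat m + 1 / 2 = (of_int i :: 'a)" by (auto elim: Ints_cases)
  hence "of_int (2 * int m + 1) = (of_int (2 * i) :: 'a)" by (simp add: field_simps)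
  hence "2 * int m + 1 = 2 * i" by (simp only: of_int_eq_iff)
  thus False by presburger
qed

text \<open>Both sides are polynomials in \<open>s\<close> that agree at all \<open>m + 1/2\<close>.
  This reaches integral \<open>s\<close>, where Cauchy denominators can vanish.\<close>

lemma minor_pairing_eq_hook_prod:
  fixes s :: "'a::field_char_0"
  assumes "\<mu> \<in> partitions k" "k \<le> n"
  shows "minor (pairing s) (beta_list n \<mu>) (beta_list n \<mu>) = hook_prod (s\<^sup>2) \<mu>"
proof (rule polynomial_fun_eqI[where x = s and u = "\<lambda>m. of_nat m + 1 / 2"
      and f = "\<lambda>s. minor (pairing s) (beta_list n \<mu>) (beta_list n \<mu>)"
      and g = "\<lambda>s. hook_prod (s\<^sup>2) \<mu>"])
  show "inj (\<lambda>m. of_nat m + 1 / 2 :: 'a)" by (auto intro: injI)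
  show "minor (pairing (of_nat m + 1 / 2)) (beta_list n \<mu>) (beta_list n \<mu>) =
      hook_prod ((of_nat m + 1 / 2 :: 'a)\<^sup>2) \<mu>" for m
    by (rule minor_pairing_eq_hook_prod_nonint[OF half_plus_nat_not_int assms])
qed (intro polynomial_fun_intros polynomial_fun_minor_pairing)+

text \<open>The last box of the last row has hook length 1, so its factor vanishes.\<close>

lemma hook_prod_1:
  assumes \<mu>: "\<mu> \<in> partitions k" and k: "0 < k"
  shows "hook_prod 1 \<mu> = 0"
proof -
  let ?l = "length \<mu>"
  have s: "sorted_wrt (\<ge>) \<mu>" "0 \<notin> set \<mu>" "\<mu> \<noteq> []" using \<mu> k by (auto simp: partitions_def)
  hence l: "1 \<le> ?l" by (simp add: Suc_le_eq)
  let ?v = "(?l, part \<mu> ?l)"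
  have pos: "0 < part \<mu> ?l" using part_pos_iff[OF s(2)] l by simp
  hence v: "?v \<in> boxes \<mu>" using l by (simp add: boxes_def)
  have "conj_part \<mu> (part \<mu> ?l) = ?l"
    using le_part_iff_le_conj_part[OF s(1) l, of "part \<mu> ?l"] pos conj_part_le[of \<mu> "part \<mu> ?l"] by simp
  hence "hook_length \<mu> ?v = 1" by (simp add: hook_length_def)
  thus ?thesis unfolding hook_prod_def using v finite_boxes by (intro prod_zero) (auto intro!: bexI[of _ ?v])
qed

section \<open>The Nekrasov--Okounkov identity and Lagrange inversion\<close>

text \<open>Each coefficient is read off from a partial product that has already stabilized in that
  degree.\<close>

definition euler_fps :: "'a::field_char_0 fps" where
  "euler_fps = Abs_fps (\<lambda>i. (\<Prod>m\<le>i. 1 - fps_X ^ Suc m) $ i)"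

lemma prod_nth_eq_euler_fps:
  "i \<le> K \<Longrightarrow> (\<Prod>m\<le>K. 1 - fps_X ^ Suc m) $ i = euler_fps $ i"
proof (induction K rule: dec_induct)
  case base
  show ?case by (simp add: euler_fps_def)
next
  case (step K)
  have "(\<Prod>m\<le>Suc K. 1 - fps_X ^ Suc m) =
      (\<Prod>m\<le>K. 1 - fps_X ^ Suc m) - (\<Prod>m\<le>K. 1 - fps_X ^ Suc m) * (fps_X ^ Suc (Suc K) :: 'a fps)"
    by (simp only: prod.atMost_Suc right_diff_distrib mult_1_right)
  thus ?case using step by (simp only: fps_sub_nth fps_X_power_mult_right_nth) simp
qed

lemma euler_fps_nth_0: "euler_fps $ 0 = 1"
  by (simp add: euler_fps_def)

lemma prodinf_eq_euler_fps:
  fixes y :: "'a::field_char_0 fps"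
  assumes y: "y $ 0 = 0"
  shows "(\<Prod>m. 1 - y ^ Suc m) = euler_fps oo y"
proof -
  have "(\<lambda>n. \<Prod>m\<le>n. 1 - y ^ Suc m) \<longlonglongrightarrow> (euler_fps oo y)"
  proof (rule tendsto_fpsI)
    fix i
    have *: "(\<Prod>m\<le>n. 1 - y ^ Suc m) $ i = (euler_fps oo y) $ i" if "i \<le> n" for n
    proof -
      have "(\<Prod>m\<le>n. 1 - y ^ Suc m) = (\<Prod>m\<le>n. 1 - fps_X ^ Suc m) oo y"
        unfolding fps_compose_prod_distrib[OF y]
        by (intro prod.cong refl)
           (simp only: fps_compose_sub_distrib fps_compose_power[OF y, symmetric] fps_X_fps_compose_startby0[OF y] fps_compose_1)
      thus ?thesis using that
        by (simp add: fps_compose_nth prod_nth_eq_euler_fps del: power_Suc)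
    qed
    thus "\<forall>\<^sub>F n in sequentially. (\<Prod>m\<le>n. 1 - y ^ Suc m) $ i = (euler_fps oo y) $ i"
      unfolding eventually_sequentially by blast
  qed
  \<comment> \<open>\<open>has_prod\<close> asks for a nonzero limit.\<close>
  moreover have "euler_fps oo y \<noteq> 0"
  proof
    assume "euler_fps oo y = 0"
    hence "(euler_fps oo y) $ 0 = 0" by simp
    thus False by (simp add: euler_fps_nth_0)
  qed
  ultimately have "(\<lambda>m. 1 - y ^ Suc m) has_prod (euler_fps oo y)"
    by (simp add: has_prod_def raw_has_prod_def)
  from has_prod_unique[OF this] show ?thesis ..
qed

section \<open>The generating function of the hook products\<close>

definition hook_fps :: "'a::field_char_0 \<Rightarrow> 'a fps" where
  "hook_fps z = Abs_fps (\<lambda>k. \<Sum>\<mu>\<in>partitions k. hook_prod z \<mu>)"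

definition partition_fps :: "'a::field_char_0 fps" where
  "partition_fps = Abs_fps (\<lambda>k. of_nat (card (partitions k)))"

text \<open>The beta lists of the partitions of \<open>K\<close> are the basis vectors in degree
  \<open>K\<close> above the lowest, so the coefficient at \<open>K\<close> is the trace at
  \<open>x = 1\<close>.\<close>

lemma hook_fps_square:
  assumes t: "0 < t"
  shows "hook_fps (of_nat t ^ 2) = euler_fps ^ (t * t) * (partition_fps :: 'a::field_char_0 fps)"
proof (rule fps_ext)
  fix K
  define n where "n = K + t"
  have "hook_fps ((of_nat t :: 'a)\<^sup>2) $ K =
      (\<Sum>\<mu>\<in>partitions K. minor (pairing (of_nat t)) (beta_list n \<mu>) (beta_list n \<mu>))"
    by (simp add: hook_fps_def minor_pairing_eq_hook_prod n_def)
  also have "\<dots> = (\<Sum>xs\<in>incr_sum n ((\<Sum>i<n. i) + K). minor (pairing (of_nat t)) xs xs)"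
    by (rule sum.reindex_bij_betw[OF bij_betw_beta_list]) (simp add: n_def)
  also have "\<dots> = (\<Sum>xs\<in>incr_sum n ((\<Sum>i<n. i) + K). minor (lower_before (rising (of_nat t)) t) xs xs)"
  proof -
    have "lower_before (rising (of_nat t)) t = (pairing (of_nat t) :: nat \<Rightarrow> nat \<Rightarrow> 'a)"
      by (intro ext lower_before_eq_pairing)
    thus ?thesis by simp
  qed
  also have "\<dots> = ((\<Prod>m\<le>K. 1 - fps_X ^ Suc m) ^ (t * t) *
     Abs_fps (\<lambda>k. of_nat (card (incr_sum n ((\<Sum>i<n. i) + k))))) $ K"
    unfolding n_def by (rule sum_minor_lower_before[OF t order_refl])
  also have "\<dots> = (euler_fps ^ (t * t) * (partition_fps :: 'a fps)) $ K"
  proof (rule fps_mult_nth_cong[where K = K])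
    fix i assume "i \<le> K"
    thus "((\<Prod>m\<le>K. 1 - fps_X ^ Suc m) ^ (t * t)) $ i = (euler_fps ^ (t * t) :: 'a fps) $ i"
      by (intro fps_power_nth_cong[where K = K] prod_nth_eq_euler_fps)
  next
    fix i assume "i \<le> K"
    thus "Abs_fps (\<lambda>k. of_nat (card (incr_sum n ((\<Sum>i<n. i) + k)))) $ i = (partition_fps :: 'a fps) $ i"
      using bij_betw_same_card[OF bij_betw_beta_list[of i n]] by (simp add: partition_fps_def n_def)
  qed simp
  finally show "hook_fps ((of_nat t :: 'a)\<^sup>2) $ K = (euler_fps ^ (t * t) * partition_fps) $ K" .
qed

lemma partitions_0: "partitions 0 = {[]}"
  by (auto simp: partitions_def) (metis list.set_intros(1) neq_Nil_conv)

lemma hook_fps_nth_0: "hook_fps z $ 0 = 1"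
proof -
  have "boxes [] = {}" by (auto simp: boxes_def)
  thus ?thesis by (simp add: hook_fps_def partitions_0 hook_prod_def)
qed

lemma hook_fps_1: "hook_fps 1 = 1"
proof (rule fps_ext)
  fix k
  show "hook_fps 1 $ k = (1 :: 'a fps) $ k"
  proof (cases "k = 0")
    case False
    thus ?thesis using hook_prod_1 by (auto simp: hook_fps_def intro!: sum.neutral)
  qed (simp add: hook_fps_nth_0)
qed

text \<open>At \<open>t = 1\<close> the left side of \<open>hook_fps_square\<close> is 1, which
  makes \<open>partition_fps\<close> the inverse of \<open>euler_fps\<close>.\<close>

lemma hook_fps_mult_euler_fps:
  assumes "0 < t"
  shows "hook_fps (of_nat t ^ 2) * euler_fps = euler_fps ^ (t * t)"
proof -
  have "euler_fps * partition_fps = (1 :: 'a fps)" using hook_fps_square[of 1, where 'a = 'a] by (simp add: hook_fps_1)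
  thus ?thesis unfolding hook_fps_square[OF assms] by (simp add: mult_ac)
qed

text \<open>At squares this is the logarithmic derivative of the product formula;
  its coefficients are polynomials in the parameter.\<close>
lemma hook_fps_ODE:
  fixes z :: "'a::field_char_0"
  shows "fps_deriv (hook_fps z) * euler_fps = fps_const (z - 1) * (hook_fps z * fps_deriv euler_fps)"
proof (rule fps_ext)
  fix k
  let ?f = "\<lambda>z. (fps_deriv (hook_fps z) * euler_fps) $ k"
  let ?g = "\<lambda>z :: 'a. (fps_const (z - 1) * (hook_fps z * fps_deriv euler_fps)) $ k"
  show "?f z = ?g z"
  proof (rule polynomial_fun_eqI[where x = z and f = ?f and g = ?g and u = "\<lambda>t. of_nat (Suc t) ^ 2"])
    show "polynomial_fun ?f" "polynomial_fun ?g"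
      unfolding fps_mult_left_const_nth
      unfolding fps_mult_nth fps_deriv_nth hook_fps_def fps_nth_Abs_fps
      by (intro polynomial_fun_intros)+
    show "inj (\<lambda>t. of_nat (Suc t) ^ 2 :: 'a)"
    proof (rule injI)
      fix s t assume "of_nat (Suc s) ^ 2 = (of_nat (Suc t) ^ 2 :: 'a)"
      hence "of_nat (Suc s ^ 2) = (of_nat (Suc t ^ 2) :: 'a)" by (simp only: of_nat_power)
      hence "Suc s ^ 2 = Suc t ^ 2" by (simp only: of_nat_eq_iff)
      thus "s = t" by (simp add: power2_eq_iff)
    qed
  next
    fix s :: nat
    define t where "t = Suc s"
    let ?E = "euler_fps :: 'a fps" and ?G = "hook_fps (of_nat t ^ 2) :: 'a fps"
    have E0: "?E \<noteq> 0" using euler_fps_nth_0 by (metis fps_zero_nth zero_neq_one)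
    have GE: "?G * ?E = ?E ^ (t * t)" by (rule hook_fps_mult_euler_fps) (simp add: t_def)
    have "fps_deriv (?G * ?E) * ?E = of_nat (t * t) * fps_deriv ?E * (?E ^ (t * t - 1) * ?E)"
      unfolding GE fps_deriv_power' by (simp only: mult.assoc)
    also have "?E ^ (t * t - 1) * ?E = ?G * ?E"
      unfolding GE by (simp add: t_def power_commutes)
    finally have "(fps_deriv ?G * ?E) * ?E = (of_nat (t * t) - 1) * (?G * fps_deriv ?E) * ?E"
      by (simp add: algebra_simps)
    hence "fps_deriv ?G * ?E = (of_nat (t * t) - 1) * (?G * fps_deriv ?E)"
      using E0 mult_right_cancel by blast
    also have "(of_nat (t * t) - 1 :: 'a fps) = fps_const (of_nat t ^ 2 - 1)"
      by (simp add: fps_of_nat[symmetric] power2_eq_square flip: fps_const_1_eq_1)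
    finally show "?f (of_nat (Suc s) ^ 2) = ?g (of_nat (Suc s) ^ 2)"
      unfolding t_def[symmetric] by simp
  qed
qed

text \<open>By \<open>hook_fps_ODE\<close> at \<open>z = 1 - n\<close> the derivative of the product
  vanishes; in characteristic 0 only the constant term 1 is left.\<close>

lemma hook_fps_mult_euler_fps_power:
  "hook_fps (1 - of_nat n) * euler_fps ^ n = (1 :: 'a::field_char_0 fps)"
proof -
  let ?E = "euler_fps :: 'a fps" and ?G = "hook_fps (1 - of_nat n) :: 'a fps"
  have "fps_deriv (?G * ?E ^ n) = 0"
  proof (cases n)
    case (Suc m)
    have c: "fps_const (1 - of_nat n - 1 :: 'a) = - of_nat n"
      by (simp add: fps_of_nat[symmetric])
    have "fps_deriv (?G * ?E ^ n) = (fps_deriv ?G * ?E + of_nat n * (?G * fps_deriv ?E)) * ?E ^ m"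
    proof -
      have "fps_deriv (?G * ?E ^ n) = ?G * (of_nat n * fps_deriv ?E * ?E ^ m) + fps_deriv ?G * (?E * ?E ^ m)"
        unfolding fps_deriv_mult fps_deriv_power' Suc by simp
      thus ?thesis by (simp only: ring_distribs mult_ac add_ac)
    qed
    also have "fps_deriv ?G * ?E + of_nat n * (?G * fps_deriv ?E) = 0"
      unfolding hook_fps_ODE c by simp
    finally show ?thesis by simp
  qed (simp add: hook_fps_1)
  hence "?G * ?E ^ n = fps_const ((?G * ?E ^ n) $ 0)" by (simp only: fps_deriv_eq_0_iff)
  also have "(?G * ?E ^ n) $ 0 = 1" by (simp add: hook_fps_nth_0 euler_fps_nth_0 startsby_one_power)
  finally show ?thesis by simp
qed

text \<open>\<open>F = fps_X * E\<close> is the compositional inverse of \<open>y\<close>, so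
  \<open>(y' o F) F' = 1\<close>. Expand in powers of \<open>F\<close> and multiply by
  \<open>V^(n + 1)\<close>: the coefficient at degree \<open>n\<close> of the term with
  \<open>F^k\<close> is the residue of \<open>F^(k - n - 1) F'\<close>, which is nonzero only for
  \<open>k = n\<close>.\<close>

lemma Lagrange_inversion:
  fixes y E :: "'a::field_char_0 fps"
  assumes y0: "y $ 0 = 0" and y: "fps_X = y * (E oo y)" and E0: "E $ 0 \<noteq> 0"
  shows "of_nat (Suc n) * y $ Suc n = (inverse E ^ Suc n) $ n"
proof -
  define V where "V = inverse E"
  have EV: "E * V = 1" using E0 by (simp add: V_def inverse_mult_eq_1')
  have V': "fps_deriv V = - fps_deriv E * V ^ 2" using E0 by (simp add: V_def fps_inverse_deriv)
  define F where "F = fps_X * E"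
  have F0: "F $ 0 = 0" and F1: "F $ 1 \<noteq> 0" using E0 by (simp_all add: F_def)
  have Fy: "F oo y = fps_X"
    unfolding F_def fps_compose_mult_distrib[OF y0] using y by (simp add: fps_X_fps_compose_startby0[OF y0])
  have "fps_inv F oo (F oo y) = (fps_inv F oo F) oo y" by (rule fps_compose_assoc[OF y0 F0])
  hence "y = fps_inv F" unfolding Fy fps_inv[OF F0 F1] by (simp add: fps_X_fps_compose_startby0[OF y0])
  hence yF: "y oo F = fps_X" using fps_inv[OF F0 F1] by simp
  have "(fps_deriv y oo F) * fps_deriv F = 1"
    using fps_compose_deriv[OF F0, of y] yF by simp
  hence "(V ^ Suc n) $ n = ((fps_deriv y oo F) * (fps_deriv F * V ^ Suc n)) $ n"
    by (simp only: mult.assoc[symmetric] mult_1_left)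
  also have "\<dots> = (\<Sum>i=0..n. \<Sum>k=0..i. fps_deriv y $ k * (F ^ k $ i) * (fps_deriv F * V ^ Suc n) $ (n - i))"
    by (simp only: fps_mult_nth[of "fps_deriv y oo F"] fps_compose_nth sum_distrib_right)
  also have "\<dots> = (\<Sum>i=0..n. \<Sum>k=0..n. fps_deriv y $ k * (F ^ k $ i) * (fps_deriv F * V ^ Suc n) $ (n - i))"
    \<comment> \<open>\<open>F ^ k\<close> starts in degree \<open>k\<close> or later, so the range
      of \<open>k\<close> can be made independent of \<open>i\<close>.\<close>
    by (intro sum.cong refl sum.mono_neutral_left) (auto simp: startsby_zero_power_prefix[OF F0])
  also have "\<dots> = (\<Sum>k=0..n. fps_deriv y $ k * (F ^ k * (fps_deriv F * V ^ Suc n)) $ n)"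
    unfolding fps_mult_nth[of "F ^ _"] by (subst sum.swap) (simp only: sum_distrib_left mult.assoc)
  also have "\<dots> = (\<Sum>k=0..n. if k = n then fps_deriv y $ n else 0)"
  proof (intro sum.cong refl)
    fix k assume "k \<in> {0..n}"
    then obtain j where n: "n = k + j" using le_Suc_ex by auto
    have "E ^ k * V ^ k = 1" using EV by (simp flip: power_mult_distrib)
    hence "F ^ k * (fps_deriv F * V ^ Suc n) = fps_X ^ k * ((E + fps_X * fps_deriv E) * V ^ Suc j)"
      by (simp add: F_def n power_mult_distrib power_add mult_ac)
    also have "(E + fps_X * fps_deriv E) * V ^ Suc j = V ^ j + fps_X * (fps_deriv E * V ^ Suc j)"
      using EV by (simp add: algebra_simps)
    finally have "F ^ k * (fps_deriv F * V ^ Suc n) = fps_X ^ k * (V ^ j + fps_X * (fps_deriv E * V ^ Suc j))" .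
    hence "(F ^ k * (fps_deriv F * V ^ Suc n)) $ n = (V ^ j + fps_X * (fps_deriv E * V ^ Suc j)) $ j"
      by (simp only: fps_X_power_mult_nth) (simp add: n del: power_Suc)
    also have "\<dots> = (if k = n then 1 else 0)"
    proof (cases j)
      case (Suc i)
      \<comment> \<open>Read at degree \<open>j - 1\<close>, this derivative shows that the two
        terms cancel: a derivative has no residue.\<close>
      have "fps_deriv (V ^ j) = - of_nat j * (fps_deriv E * V ^ Suc j)"
        unfolding fps_deriv_power' V' by (simp add: Suc power2_eq_square algebra_simps)
      hence "of_nat j * V ^ j $ j = (- of_nat j * (fps_deriv E * V ^ Suc j)) $ i"
        using fps_deriv_nth[of "V ^ j" i] by (simp add: Suc)
      also have "\<dots> = - (of_nat j * (fps_deriv E * V ^ Suc j) $ i)"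
        by (simp add: fps_of_nat[symmetric] del: power_Suc)
      finally have "of_nat j * (V ^ j $ j + (fps_deriv E * V ^ Suc j) $ i) = 0"
        by (simp add: algebra_simps)
      hence "V ^ j $ j + (fps_deriv E * V ^ Suc j) $ i = 0"
        using Suc by (simp only: mult_eq_0_iff of_nat_eq_0_iff) simp
      thus ?thesis using Suc n by simp
    qed (simp add: n)
    finally show "fps_deriv y $ k * (F ^ k * (fps_deriv F * V ^ Suc n)) $ n =
      (if k = n then fps_deriv y $ n else 0)" by simp
  qed
  finally show ?thesis by (simp add: V_def)
qed

theorem theorem9p1:
  fixes y :: "'a :: field_char_0 fps"
  assumes "fps_nth y 0 = 0"
    and "fps_X = y * (\<Prod>m. 1 - y ^ Suc m)"
  shows "y = Abs_fps (\<lambda>n. if n = 0 then 0 else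
           1 / of_nat n * (\<Sum>\<mu>\<in>partitions (n - 1). \<Prod>v\<in>boxes \<mu>.
             (1 + of_nat (n - 1) / of_int (hook_length \<mu> v) ^ 2)))"
proof (rule fps_ext)
  fix n
  show "y $ n = Abs_fps (\<lambda>n. if n = 0 then 0 else
           1 / of_nat n * (\<Sum>\<mu>\<in>partitions (n - 1). \<Prod>v\<in>boxes \<mu>.
             (1 + of_nat (n - 1) / of_int (hook_length \<mu> v) ^ 2))) $ n"
  proof (cases n)
    case 0
    thus ?thesis using assms(1) by simp
  next
    case (Suc m)
    have "of_nat (Suc m) * y $ Suc m = (inverse euler_fps ^ Suc m) $ m"
      using assms prodinf_eq_euler_fps[OF assms(1)]
      by (intro Lagrange_inversion) (simp_all add: euler_fps_nth_0)
    also have "inverse euler_fps ^ Suc m = (hook_fps (1 - of_nat (Suc m)) :: 'a fps)"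
      unfolding fps_inverse_power[symmetric]
      by (rule fps_inverse_unique) (use hook_fps_mult_euler_fps_power[of "Suc m"] in \<open>simp only: mult.commute\<close>)
    \<comment> \<open>The parameter \<open>1 - Suc m\<close> equals \<open>- m\<close>, which turns
      the factors \<open>1 - z/h^2\<close> into \<open>1 + m/h^2\<close>.\<close>
    finally have "of_nat (Suc m) * y $ Suc m = (\<Sum>\<mu>\<in>partitions m. \<Prod>v\<in>boxes \<mu>.
        1 + of_nat m / of_int (hook_length \<mu> v) ^ 2)"
      by (simp add: hook_fps_def hook_prod_def)
    moreover have "of_nat (Suc m) \<noteq> (0 :: 'a)" by (rule of_nat_neq_0)
    ultimately show ?thesis by (simp add: Suc field_simps del: of_nat_Suc)
  qed
qed

end
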